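(* Let $A,B\subset\mathbb{R}^2$ be finite two-dimensional sets such that $A\subset\partial[A]$ and $B\subset\partial[B]$. Then there exist triangulations $T_A$ and $T_B$ of $[A]$ and $[B]$ using $A$ and $B$, respectively, as vertex sets, and a mixed subdivision $M$ of $[A+B]$ corresponding to $T_A$ and $T_B$, such that $$|M_{11}|\ \ge\ \sqrt{|T_A|\cdot|T_B|}.$$
   Context: $[X]$ denotes convex hull and $\partial[X]$ its boundary; a finite set in $\mathbb{R}^2$ is two-dimensional if it is not contained in a line. A triangulation $T_X$ of $X$ is a triangulation of $[X]$ using $X$ as the set of vertices; $|T_X|$ is its number of triangles. For finite two-dimensional $A,B$ with triangulations $T_A,T_B$, a mixed subdivision of $[A+B]$ corresponding to $T_A$ and $T_B$ is a polygonal subdivision $M$ of $[A+B]$ such that (i) every $k$-cell of $M$ is of the form $F+G$ where $F$ is an $i$-simplex of $T_A$ and $G$ is a $j$-simplex of $T_B$ with $i+j=k$; (ii) for any triangles $F$ of $T_A$ and $G$ of $T_B$ there is a unique $b\in B$ and a unique $a\in A$ such that $F+b\in M$ and $a+G\in M$. $M_{11}$ denotes the set of parallelograms of $M$, i.e. the 2-cells $F+G$ with $F$ an edge of $T_A$ and $G$ an edge of $T_B$. *)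

theory Defs
  imports "HOL-Analysis.Analysis"
begin

type_synonym plane = "real ^ 2"

(* A simplicial complex of the library contains the empty simplex, of dimension -1.
   Asking the 0-simplices to be exactly the points of X means that every point of X is used. *)
definition triangulation_of :: "plane set \<Rightarrow> plane set set \<Rightarrow> bool" where
  "triangulation_of X T \<longleftrightarrow>
     simplicial_complex T \<and> \<Union>T = convex hull X \<and> {v. {v} \<in> T} = X"

definition triangles :: "plane set set \<Rightarrow> plane set set" where
  "triangles T = {F \<in> T. 2 simplex F}"

(* Cells are closed; faces are those of the library's face_of, so that subdivisions are
   face-to-face. The empty face is not counted as a cell. *)
definition polygonal_subdivision :: "plane set \<Rightarrow> plane set set \<Rightarrow> bool" where
  "polygonal_subdivision P \<C> \<longleftrightarrow>
     finite \<C> \<and>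
     (\<forall>C\<in>\<C>. polytope C \<and> C \<noteq> {}) \<and>
     (\<forall>C\<in>\<C>. \<forall>D. D face_of C \<and> D \<noteq> {} \<longrightarrow> D \<in> \<C>) \<and>
     (\<forall>C\<in>\<C>. \<forall>D\<in>\<C>. (C \<inter> D) face_of C \<and> (C \<inter> D) face_of D) \<and>
     \<Union>\<C> = P"

(* A cell is recorded as a pair (F, G) that stands for the polygon F + G (Minkowski sum), and
   a polygon carries only one such pair. The pair matters: if triangles F of T_A and G of T_B
   are translates of each other, then F + b and a + G can be the same subset of the plane, and
   the uniqueness of a and b has to refer to how the cell is written as a sum. For instance
   if A = B is the vertex set of a triangle, every suitable subdivision of [A + B] contains two
   translates of that triangle, one of them as F + b and the other as a + G. *)
definition mixed_subdivision ::
  "plane set \<Rightarrow> plane set \<Rightarrow> plane set set \<Rightarrow> plane set set \<Rightarrow> (plane set \<times> plane set) set \<Rightarrow> bool"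
where
  "mixed_subdivision A B TA TB M \<longleftrightarrow>
     inj_on (\<lambda>(F, G). F + G) M \<and>
     polygonal_subdivision (convex hull (A + B)) ((\<lambda>(F, G). F + G) ` M) \<and>
     (\<forall>(F, G)\<in>M. F \<in> TA \<and> G \<in> TB \<and>
        (\<exists>i j :: nat. int i simplex F \<and> int j simplex G \<and> aff_dim (F + G) = int (i + j))) \<and>
     (\<forall>F\<in>triangles TA. \<forall>G\<in>triangles TB.
        (\<exists>!b. b \<in> B \<and> (F, {b}) \<in> M) \<and> (\<exists>!a. a \<in> A \<and> ({a}, G) \<in> M))"

definition parallelograms :: "(plane set \<times> plane set) set \<Rightarrow> (plane set \<times> plane set) set" where
  "parallelograms M = {(F, G) \<in> M. aff_dim (F + G) = 2 \<and> 1 simplex F \<and> 1 simplex G}"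

end

(* Lift the points of A and B to convex heights and add a large linear function, with gradient p,
   to the heights of B. The lower faces of the lifted sets give the triangulations and the mixed
   subdivision. An edge of the boundary of A and an edge of the boundary of B span a parallelogram
   as soon as p lies in the cone spanned by the outer normal of the first and the inner normal of
   the second, that is, as soon as the normal rays from two far apart points cross. As all points of
   A are on the boundary, A has n = |A| boundary edges, and a triangulation has at most n - 2
   triangles, because a triangle is determined by its middle vertex.

   It remains to choose p. Among the line directions of the edges take an interval W, containing x
   edges of A and y edges of B; let m = |B|. For p and -p along either end of W at least
   x (m - y) + y (n - x) crossings occur in total. A median argument yields W for which this is at
   least 4 sqrt ((n - 2) (m - 2)); by the inequality of the means it suffices that 2 <= x <= n - 2
   and 2 <= y <= m - 2. *)

theory Submission
  imports Defs "HOL-Computational_Algebra.Polynomial"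
begin

section \<open>Regular subdivisions\<close>

text \<open>In the dual plane of the gradients \<open>w\<close>, a boundary edge is a lower edge
  along the far part of a ray that points along its inner normal. Adding
  \<open>R * (p \<bullet> b)\<close> translates the rays of B by \<open>- R p\<close>. For large R
  the apexes hardly matter any more: whether two rays cross depends only on the directions of the
  edges and of p. As there are finitely many pairs, one R serves all crossings and avoids all
  degenerate positions.

  The factor 4 enters twice and cancels. Four directions of p are averaged; on the other side, two
  factors 2 come from \<open>x (n - x) >= 2 (n - 2)\<close> and its analogue for y, under the root,
  and another 2 from the inequality of the means.

  The main obstacle is parallelism. Several edges of A and of B may share one line direction, so the
  counts x and y cannot be prescribed: both may jump when an end of the interval passes a single
  direction. Therefore the pieces before, at and after a median direction compete, and the cases in
  which a piece holds just one edge of A or of B, or n = 3, need separate estimates.\<close>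

lemma finite_ex_minimum:
  fixes f :: "'a \<Rightarrow> real"
  assumes "finite S" "S \<noteq> {}"
  shows "\<exists>s\<in>S. \<forall>x\<in>S. f s \<le> f x"
  using arg_min_if_finite(1)[OF assms, of f] arg_min_least[OF assms, of _ f] by blast

text \<open>The index set allows for coinciding points: a point of A + B may arise from several
  pairs (a, b) with different heights, and the cells of A + B are indexed by pairs.\<close>

definition minset :: "'i set \<Rightarrow> ('i \<Rightarrow> 'a::euclidean_space) \<Rightarrow> ('i \<Rightarrow> real) \<Rightarrow> 'a \<Rightarrow> 'i set" where
  "minset I x h w = {i \<in> I. \<forall>j\<in>I. w \<bullet> x i + h i \<le> w \<bullet> x j + h j}"

definition cell :: "'i set \<Rightarrow> ('i \<Rightarrow> 'a::euclidean_space) \<Rightarrow> ('i \<Rightarrow> real) \<Rightarrow> 'a \<Rightarrow> 'a set" where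
  "cell I x h w = convex hull (x ` minset I x h w)"

lemma minset_subset: "minset I x h w \<subseteq> I"
  by (auto simp: minset_def)

lemma minset_nonempty:
  assumes "finite I" "I \<noteq> {}"
  shows "minset I x h w \<noteq> {}"
  using finite_ex_minimum[OF assms, of "\<lambda>i. w \<bullet> x i + h i"] by (auto simp: minset_def)

lemma minset_value:
  assumes "i \<in> minset I x h w"
  shows "j \<in> minset I x h w \<longleftrightarrow> j \<in> I \<and> w \<bullet> x j + h j = w \<bullet> x i + h i"
  using assms by (fastforce simp: minset_def)

text \<open>The left side is a face of the hull. A face of the hull of a compact set is the hull of
  some of its points, and these must lie in the hyperplane.\<close>

lemma convex_hull_Int_supporting_hyperplane:
  fixes S :: "'a::euclidean_space set"
  assumes "compact S" and le: "\<And>s. s \<in> S \<Longrightarrow> c \<bullet> s \<le> m"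
  shows "convex hull S \<inter> {x. c \<bullet> x = m} = convex hull (S \<inter> {x. c \<bullet> x = m})"
proof
  have "convex hull S \<subseteq> {x. c \<bullet> x \<le> m}"
    by (intro hull_minimal) (auto simp: le convex_halfspace_le)
  then have "(convex hull S \<inter> {x. c \<bullet> x = m}) face_of convex hull S"
    by (intro face_of_Int_supporting_hyperplane_le) auto
  then obtain S' where S': "S' \<subseteq> S" "convex hull S \<inter> {x. c \<bullet> x = m} = convex hull S'"
    using \<open>compact S\<close> face_of_convex_hull_subset by metis
  then have "S' \<subseteq> S \<inter> {x. c \<bullet> x = m}"
    using hull_subset[of S' convex] by blast
  then show "convex hull S \<inter> {x. c \<bullet> x = m} \<subseteq> convex hull (S \<inter> {x. c \<bullet> x = m})"
    using S' hull_mono by metis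
next
  have "convex hull (S \<inter> {x. c \<bullet> x = m}) \<subseteq> convex hull S"
    by (intro hull_mono) auto
  moreover have "convex hull (S \<inter> {x. c \<bullet> x = m}) \<subseteq> {x. c \<bullet> x = m}"
    by (intro hull_minimal) (auto simp: convex_hyperplane)
  ultimately show "convex hull (S \<inter> {x. c \<bullet> x = m}) \<subseteq> convex hull S \<inter> {x. c \<bullet> x = m}"
    by auto
qed

text \<open>The cells are the projections of the lower faces of the lifted polytope.\<close>

definition lifted :: "'i set \<Rightarrow> ('i \<Rightarrow> 'a::euclidean_space) \<Rightarrow> ('i \<Rightarrow> real) \<Rightarrow> ('a \<times> real) set" where
  "lifted I x h = convex hull ((\<lambda>i. (x i, h i)) ` I)"

lemma lifted_ge:
  assumes "i \<in> minset I x h w" "(y, t) \<in> lifted I x h"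
  shows "w \<bullet> x i + h i \<le> w \<bullet> y + t"
proof -
  have "lifted I x h \<subseteq> {k. (w, 1) \<bullet> k \<ge> w \<bullet> x i + h i}"
    unfolding lifted_def using assms(1)
    by (intro hull_minimal) (auto simp: convex_halfspace_ge minset_def)
  then show ?thesis
    using assms(2) by auto
qed

text \<open>The functional with normal (w, 1) attains its minimum over the lifted polytope on the
  hull of the lifted minimizers, and this face projects onto the cell. Cells of different gradients
  can then be compared by heights over the same point.\<close>

lemma cell_iff:
  assumes "finite I" "i \<in> minset I x h w"
  shows "y \<in> cell I x h w \<longleftrightarrow> (\<exists>t. (y, t) \<in> lifted I x h \<and> w \<bullet> y + t = w \<bullet> x i + h i)"
proof -
  define L where "L = (\<lambda>j. (x j, h j))"
  define m where "m = w \<bullet> x i + h i"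
  have "convex hull (L ` I) \<inter> {k. (-w, -1) \<bullet> k = -m}
      = convex hull (L ` I \<inter> {k. (-w, -1) \<bullet> k = -m})"
    using assms by (intro convex_hull_Int_supporting_hyperplane finite_imp_compact)
      (auto simp: L_def m_def minset_def)
  also have "L ` I \<inter> {k. (-w, -1) \<bullet> k = -m} = L ` minset I x h w"
    using minset_value[OF assms(2)] by (force simp: L_def m_def algebra_simps)
  finally have eq: "convex hull (L ` I) \<inter> {k. (-w, -1) \<bullet> k = -m}
      = convex hull (L ` minset I x h w)" .
  have "cell I x h w = fst ` (convex hull (L ` minset I x h w))"
    by (simp add: cell_def convex_hull_linear_image linear_fst image_image L_def)
  then have "cell I x h w = fst ` (convex hull (L ` I) \<inter> {k. (-w, -1) \<bullet> k = -m})"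
    using eq by simp
  then show ?thesis
    by (force simp: lifted_def L_def m_def)
qed

section \<open>Faces, intersections and union of the cells\<close>

lemma cell_nonempty: "finite I \<Longrightarrow> I \<noteq> {} \<Longrightarrow> cell I x h w \<noteq> {}"
  by (simp add: cell_def minset_nonempty)

lemma polytope_cell: "finite I \<Longrightarrow> polytope (cell I x h w)"
  unfolding cell_def
  by (intro polytope_convex_hull finite_imageI finite_subset[OF minset_subset])

lemma finite_cells: "finite I \<Longrightarrow> finite (range (cell I x h))"
proof -
  assume "finite I"
  have "range (cell I x h) \<subseteq> (\<lambda>J. convex hull (x ` J)) ` Pow I"
    using minset_subset by (force simp: cell_def)
  then show ?thesis
    using \<open>finite I\<close> by (meson finite_Pow_iff finite_imageI finite_subset)
qed

text \<open>A cell remembers which indices attain the minimum. If s is minimal for w, no lifted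
  point over \<open>x s\<close> lies below \<open>h s\<close>; if \<open>x s\<close> also lies in
  the cell of v, the lower face for v contains a point over it, which is at least as high as
  \<open>h s\<close>, so s is minimal for v. This is what makes the label (F, G) of a mixed cell
  recoverable from F + G.\<close>

lemma minset_eq_iff_cell_eq:
  assumes "finite I"
  shows "minset I x h w = minset I x h v \<longleftrightarrow> cell I x h w = cell I x h v"
proof
  assume eq: "cell I x h w = cell I x h v"
  have *: "minset I x h w \<subseteq> minset I x h v"
    if eq: "cell I x h w = cell I x h v" for w v
  proof
    fix s assume s: "s \<in> minset I x h w"
    then have "s \<in> I"
      by (simp add: minset_def)
    then obtain i where i: "i \<in> minset I x h v"
      using minset_nonempty[OF \<open>finite I\<close>, of x h v] by blast
    have "x s \<in> cell I x h w"
      using s unfolding cell_def by (simp add: hull_inc)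
    then obtain t where t: "(x s, t) \<in> lifted I x h" "v \<bullet> x s + t = v \<bullet> x i + h i"
      using eq cell_iff[OF \<open>finite I\<close> i] by auto
    have "(x s, h s) \<in> lifted I x h"
      unfolding lifted_def using \<open>s \<in> I\<close> by (auto intro: hull_inc)
    have "t \<ge> h s"
      using lifted_ge[OF s t(1)] by simp
    moreover have "v \<bullet> x i + h i \<le> v \<bullet> x s + h s"
      using i \<open>s \<in> I\<close> by (simp add: minset_def)
    ultimately show "s \<in> minset I x h v"
      using minset_value[OF i, of s] t \<open>s \<in> I\<close> by simp
  qed
  show "minset I x h w = minset I x h v"
    using *[OF eq] *[OF eq[symmetric]] by blast
qed (simp add: cell_def)

text \<open>Over the first cell the height is an affine function of y, and the supporting plane for
  v bounds it from below. Hence \<open>(w - v) \<bullet> y <= b\<close> there, with equality exactly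
  where both lower faces have the same height, which is over the common points.\<close>

lemma cell_Int_face:
  assumes "finite I" "I \<noteq> {}"
  shows "(cell I x h w \<inter> cell I x h v) face_of cell I x h w"
proof -
  obtain i j where i: "i \<in> minset I x h w" and j: "j \<in> minset I x h v"
    using minset_nonempty[OF assms, of x h] by (metis ex_in_conv)
  define b where "b = (w \<bullet> x i + h i) - (v \<bullet> x j + h j)"
  have le: "(w - v) \<bullet> y \<le> b" if "y \<in> cell I x h w" for y
    using that lifted_ge[OF j] unfolding cell_iff[OF assms(1) i] b_def
    by (fastforce simp: inner_diff_left)
  have "cell I x h w \<inter> cell I x h v = cell I x h w \<inter> {y. (w - v) \<bullet> y = b}"
  proof (intro equalityI subsetI)
    fix y assume y: "y \<in> cell I x h w \<inter> cell I x h v"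
    then obtain t t' where "(y, t) \<in> lifted I x h" "w \<bullet> y + t = w \<bullet> x i + h i"
        "(y, t') \<in> lifted I x h" "v \<bullet> y + t' = v \<bullet> x j + h j"
      using cell_iff[OF assms(1) i] cell_iff[OF assms(1) j] by auto
    moreover have "w \<bullet> x i + h i \<le> w \<bullet> y + t'" "v \<bullet> x j + h j \<le> v \<bullet> y + t"
      using lifted_ge[OF i] lifted_ge[OF j] calculation by blast+
    ultimately have "(w - v) \<bullet> y = b"
      by (simp add: b_def inner_diff_left)
    then show "y \<in> cell I x h w \<inter> {y. (w - v) \<bullet> y = b}"
      using y by simp
  next
    fix y assume y: "y \<in> cell I x h w \<inter> {y. (w - v) \<bullet> y = b}"
    then obtain t where t: "(y, t) \<in> lifted I x h" "w \<bullet> y + t = w \<bullet> x i + h i"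
      using cell_iff[OF assms(1) i] by auto
    have "v \<bullet> y + t = v \<bullet> x j + h j"
      using y t by (simp add: b_def inner_diff_left)
    then have "y \<in> cell I x h v"
      using cell_iff[OF assms(1) j] t by auto
    then show "y \<in> cell I x h w \<inter> cell I x h v"
      using y by auto
  qed
  moreover have "(cell I x h w \<inter> {y. (w - v) \<bullet> y = b}) face_of cell I x h w"
    by (rule face_of_Int_supporting_hyperplane_le) (auto simp: le cell_def)
  ultimately show ?thesis
    by simp
qed

text \<open>Faces of polytopes are exposed, say by c. Tilting w to \<open>w - \<epsilon> c\<close>
  prefers, among the old minimizers, those with the largest value of c, while for small \<epsilon>
  no index that was not minimal before can catch up.\<close>

lemma face_of_cell:
  assumes "finite I" "I \<noteq> {}" and face: "D face_of cell I x h w" and "D \<noteq> {}"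
  obtains v where "D = cell I x h v"
proof -
  have "D exposed_face_of cell I x h w"
    using face assms(1) polytope_cell polytope_imp_polyhedron exposed_face_of_polyhedron by blast
  then obtain c b where le: "cell I x h w \<subseteq> {y. c \<bullet> y \<le> b}"
      and D: "D = cell I x h w \<inter> {y. c \<bullet> y = b}"
    by (auto simp: exposed_face_of_def)
  define M where "M = minset I x h w"
  define N where "N = {i \<in> M. c \<bullet> x i = b}"
  have MI: "M \<subseteq> I" "finite M"
    using minset_subset assms(1) finite_subset unfolding M_def by metis+
  have cM: "c \<bullet> x i \<le> b" if "i \<in> M" for i
    using le that hull_subset[of "x ` M" convex] unfolding cell_def M_def by blast
  have "D = convex hull (x ` M \<inter> {y. c \<bullet> y = b})"
    unfolding D cell_def M_def[symmetric]
    using cM MI by (intro convex_hull_Int_supporting_hyperplane finite_imp_compact) auto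
  also have "x ` M \<inter> {y. c \<bullet> y = b} = x ` N"
    by (auto simp: N_def)
  finally have DN: "D = convex hull (x ` N)" .
  then obtain s where s: "s \<in> N"
    using \<open>D \<noteq> {}\<close> by fastforce
  then have sM: "s \<in> minset I x h w" and "s \<in> I" and cs: "c \<bullet> x s = b"
    using MI by (auto simp: N_def M_def)
  define g where "g \<epsilon> i = ((w - \<epsilon> *\<^sub>R c) \<bullet> x i + h i) - ((w - \<epsilon> *\<^sub>R c) \<bullet> x s + h s)" for \<epsilon> :: real and i
  have g: "g \<epsilon> i = ((w \<bullet> x i + h i) - (w \<bullet> x s + h s)) + \<epsilon> * (b - c \<bullet> x i)" for \<epsilon> i
    by (simp add: g_def cs[symmetric] inner_diff_left algebra_simps)
  have "\<forall>\<^sub>F \<epsilon> in at_right 0. g \<epsilon> i > 0" if i: "i \<in> I - N" for i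
  proof (cases "i \<in> M")
    case True
    then have "c \<bullet> x i < b"
      using cM[of i] i by (auto simp: N_def)
    moreover have "w \<bullet> x i + h i = w \<bullet> x s + h s"
      using True minset_value[OF sM] by (auto simp: M_def)
    ultimately have "g \<epsilon> i > 0" if "\<epsilon> > 0" for \<epsilon>
      using that by (simp add: g)
    then show ?thesis
      by (auto simp: eventually_at_right_less elim: eventually_mono
          intro!: eventually_mono[OF eventually_at_right_less])
  next
    case False
    have "w \<bullet> x s + h s \<le> w \<bullet> x i + h i"
      using sM i by (auto simp: minset_def)
    then have "w \<bullet> x i + h i > w \<bullet> x s + h s"
      using False i minset_value[OF sM, of i] by (auto simp: M_def)
    moreover have "((\<lambda>\<epsilon>. g \<epsilon> i) \<longlongrightarrow> ((w \<bullet> x i + h i) - (w \<bullet> x s + h s)) + 0 * (b - c \<bullet> x i)) (at_right 0)"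
      unfolding g by (intro tendsto_intros)
    ultimately show ?thesis
      by (intro order_tendstoD(1)) auto
  qed
  then have "\<forall>\<^sub>F \<epsilon> in at_right 0. \<forall>i\<in>I - N. g \<epsilon> i > 0"
    using assms(1) by (intro eventually_ball_finite) auto
  then obtain \<epsilon> where \<epsilon>: "\<And>i. i \<in> I - N \<Longrightarrow> g \<epsilon> i > 0"
    using eventually_happens' trivial_limit_at_right_real by (metis (no_types, lifting))
  have gN: "g \<epsilon> i = 0" if "i \<in> N" for i
    using that minset_value[OF sM, of i] by (auto simp: g N_def M_def)
  have NI: "N \<subseteq> I"
    using MI by (auto simp: N_def)
  have sv: "s \<in> minset I x h (w - \<epsilon> *\<^sub>R c)"
  proof -
    have "g \<epsilon> i \<ge> 0" if "i \<in> I" for i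
      using \<epsilon>[of i] gN[of i] that by (cases "i \<in> N") auto
    then show ?thesis
      using \<open>s \<in> I\<close> by (simp add: minset_def g_def)
  qed
  have "minset I x h (w - \<epsilon> *\<^sub>R c) = N"
  proof (intro equalityI subsetI)
    fix i assume "i \<in> minset I x h (w - \<epsilon> *\<^sub>R c)"
    then have "i \<in> I" "g \<epsilon> i = 0"
      using minset_value[OF sv, of i] by (auto simp: g_def)
    then show "i \<in> N"
      using \<epsilon>[of i] by (cases "i \<in> N") auto
  next
    fix i assume "i \<in> N"
    then have "i \<in> I" "g \<epsilon> i = 0"
      using gN NI by auto
    then show "i \<in> minset I x h (w - \<epsilon> *\<^sub>R c)"
      using minset_value[OF sv, of i] by (simp add: g_def)
  qed
  then show ?thesis
    using that[of "w - \<epsilon> *\<^sub>R c"] DN by (simp add: cell_def)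
qed

text \<open>The lowest point of the lifted polytope over y lies on a supporting hyperplane, which is
  not vertical because y is an interior point. Its normal, scaled to last coordinate 1, gives the
  gradient of a cell through y.\<close>

lemma interior_subset_Union_cells:
  assumes "finite I" "I \<noteq> {}"
  shows "interior (convex hull (x ` I)) \<subseteq> (\<Union>w. cell I x h w)"
proof
  fix y assume y: "y \<in> interior (convex hull (x ` I))"
  define K where "K = lifted I x h"
  have K: "compact K" "convex K" "K \<noteq> {}"
    using assms unfolding K_def lifted_def
    by (auto intro: finite_imp_compact_convex_hull)
  have fstK: "fst ` K = convex hull (x ` I)"
    by (simp add: K_def lifted_def convex_hull_linear_image linear_fst image_image)
  define Y where "Y = K \<inter> ({y} \<times> UNIV)"
  have "compact Y"
    unfolding Y_def by (intro compact_Int_closed K closed_Times) auto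
  moreover have "Y \<noteq> {}"
    using y interior_subset fstK unfolding Y_def by fastforce
  ultimately obtain k where k: "k \<in> Y" and kmin: "\<And>k'. k' \<in> Y \<Longrightarrow> snd k \<le> snd k'"
    using continuous_attains_inf[of Y snd] continuous_on_snd continuous_on_id by blast
  obtain \<tau> where k\<tau>: "k = (y, \<tau>)"
    using k by (auto simp: Y_def)
  \<comment> \<open>The open vertical ray below the lowest point misses K. A hyperplane separating
    the two must pass through the lowest point, the limit of the ray.\<close>
  define Z where "Z = {y} \<times> {t. t < \<tau>}"
  have "K \<inter> Z = {}"
    using kmin unfolding k\<tau> Y_def Z_def by fastforce
  moreover have "convex Z"
    unfolding Z_def by (intro convex_Times) (auto simp: convex_real_interval lessThan_def[symmetric])
  moreover have "Z \<noteq> {}"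
    by (auto simp: Z_def intro: lt_ex)
  ultimately obtain a b where a: "a \<noteq> 0" and aZ: "\<And>z. z \<in> Z \<Longrightarrow> a \<bullet> z \<le> b" and aK: "\<And>k. k \<in> K \<Longrightarrow> a \<bullet> k \<ge> b"
    using separating_hyperplane_sets[of Z K] K by blast
  obtain c \<gamma> where a_eq: "a = (c, \<gamma>)"
    by fastforce
  have Zle: "c \<bullet> y + \<gamma> * t \<le> b" if "t < \<tau>" for t
    using aZ[of "(y, t)"] that by (simp add: Z_def a_eq)
  have lim: "c \<bullet> y + \<gamma> * \<tau> \<le> b"
  proof (rule tendsto_upperbound)
    show "((\<lambda>t. c \<bullet> y + \<gamma> * t) \<longlongrightarrow> c \<bullet> y + \<gamma> * \<tau>) (at_left \<tau>)"
      by (intro tendsto_intros)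
    show "\<forall>\<^sub>F t in at_left \<tau>. c \<bullet> y + \<gamma> * t \<le> b"
      using Zle by (auto simp: eventually_at_left_field intro: exI[of _ "\<tau> - 1"])
  qed auto
  have "(y, \<tau>) \<in> K"
    using k by (auto simp: Y_def k\<tau>)
  then have eq: "c \<bullet> y + \<gamma> * \<tau> = b"
    using aK[of "(y, \<tau>)"] lim by (simp add: a_eq)
  have "\<gamma> \<ge> 0"
    using Zle[of "\<tau> - 1"] eq by (simp add: algebra_simps)
  \<comment> \<open>A vertical hyperplane would make y minimize the nonzero functional c over the
    hull, but from an interior point one can still move against c.\<close>
  moreover have "\<gamma> \<noteq> 0"
  proof
    assume "\<gamma> = 0"
    then have c: "c \<noteq> 0"
      using a a_eq by (auto simp: zero_prod_def)
    have ge: "c \<bullet> y \<le> c \<bullet> z" if "z \<in> convex hull (x ` I)" for z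
    proof -
      obtain t where "(z, t) \<in> K"
        using \<open>z \<in> convex hull (x ` I)\<close> fstK by (metis (no_types, lifting) imageE prod.collapse)
      then show ?thesis
        using aK[of "(z, t)"] eq \<open>\<gamma> = 0\<close> by (simp add: a_eq)
    qed
    obtain e where e: "e > 0" "cball y e \<subseteq> convex hull (x ` I)"
      using y mem_interior_cball by blast
    define z where "z = y - (e / norm c) *\<^sub>R c"
    have "z \<in> cball y e"
      using e c by (simp add: z_def dist_norm)
    then have "c \<bullet> y \<le> c \<bullet> z"
      using e ge by auto
    moreover have "c \<bullet> z < c \<bullet> y"
      using e c by (simp add: z_def inner_diff_right)
    ultimately show False
      by simp
  qed
  ultimately have \<gamma>: "\<gamma> > 0"
    by simp
  define w where "w = c /\<^sub>R \<gamma>"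
  obtain i where i: "i \<in> minset I x h w"
    using minset_nonempty[OF assms, of x h w] by blast
  then have "(x i, h i) \<in> K"
    unfolding K_def lifted_def by (intro hull_inc) (auto simp: minset_def)
  then have "c \<bullet> x i + \<gamma> * h i \<ge> c \<bullet> y + \<gamma> * \<tau>"
    using aK[of "(x i, h i)"] eq by (simp add: a_eq)
  moreover have "w \<bullet> x i + h i = (c \<bullet> x i + \<gamma> * h i) / \<gamma>" "w \<bullet> y + \<tau> = (c \<bullet> y + \<gamma> * \<tau>) / \<gamma>"
    using \<gamma> by (auto simp: w_def field_simps)
  ultimately have "w \<bullet> x i + h i \<ge> w \<bullet> y + \<tau>"
    using \<gamma> by (simp add: divide_right_mono)
  then have "w \<bullet> y + \<tau> = w \<bullet> x i + h i"
    using lifted_ge[OF i] \<open>(y, \<tau>) \<in> K\<close> by (fastforce simp: K_def)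
  then have "y \<in> cell I x h w"
    using cell_iff[OF assms(1) i] \<open>(y, \<tau>) \<in> K\<close> by (auto simp: K_def)
  then show "y \<in> (\<Union>w. cell I x h w)"
    by blast
qed

text \<open>There are finitely many closed cells, so their union is closed; a convex set with
  nonempty interior lies in the closure of that interior.\<close>

lemma Union_cells:
  assumes "finite I" "I \<noteq> {}" and int: "interior (convex hull (x ` I)) \<noteq> {}"
  shows "(\<Union>w. cell I x h w) = convex hull (x ` I)"
proof
  show "(\<Union>w. cell I x h w) \<subseteq> convex hull (x ` I)"
    unfolding cell_def by (intro UN_least hull_mono image_mono minset_subset)
  have "closed (\<Union>(range (cell I x h)))"
    using finite_cells[OF assms(1)] polytope_imp_closed[OF polytope_cell[OF assms(1)]]
    by (intro closed_Union) auto
  then have "closure (interior (convex hull (x ` I))) \<subseteq> (\<Union>w. cell I x h w)"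
    by (rule closure_minimal[OF interior_subset_Union_cells[OF assms(1,2)]])
  moreover have "convex hull (x ` I) \<subseteq> closure (interior (convex hull (x ` I)))"
    using int by (simp add: convex_closure_interior closure_subset)
  ultimately show "convex hull (x ` I) \<subseteq> (\<Union>w. cell I x h w)"
    by blast
qed

lemma polygonal_subdivision_cells:
  fixes x :: "'i \<Rightarrow> plane"
  assumes "finite I" "I \<noteq> {}" "interior (convex hull (x ` I)) \<noteq> {}"
  shows "polygonal_subdivision (convex hull (x ` I)) (range (cell I x h))"
  unfolding polygonal_subdivision_def
proof (intro conjI ballI allI impI)
  show "finite (range (cell I x h))"
    by (rule finite_cells[OF assms(1)])
  show "\<Union>(range (cell I x h)) = convex hull (x ` I)"
    by (rule Union_cells[OF assms])
next
  fix C assume "C \<in> range (cell I x h)"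
  then obtain w where C: "C = cell I x h w"
    by blast
  show "polytope C" "C \<noteq> {}"
    unfolding C by (rule polytope_cell[OF assms(1)], rule cell_nonempty[OF assms(1,2)])
  show "D \<in> range (cell I x h)" if "D face_of C \<and> D \<noteq> {}" for D
    using that unfolding C by (metis face_of_cell[OF assms(1,2)] rangeI)
  fix D assume "D \<in> range (cell I x h)"
  then obtain v where D: "D = cell I x h v"
    by blast
  show "(C \<inter> D) face_of C"
    unfolding C D by (rule cell_Int_face[OF assms(1,2)])
  show "(C \<inter> D) face_of D"
    unfolding C D by (subst Int_commute) (rule cell_Int_face[OF assms(1,2)])
qed

section \<open>Mixed subdivisions from heights\<close>

abbreviation low :: "plane set \<Rightarrow> (plane \<Rightarrow> real) \<Rightarrow> plane \<Rightarrow> plane set" where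
  "low A \<equiv> minset A (\<lambda>a. a)"

abbreviation low_cell :: "plane set \<Rightarrow> (plane \<Rightarrow> real) \<Rightarrow> plane \<Rightarrow> plane set" where
  "low_cell A \<equiv> cell A (\<lambda>a. a)"

text \<open>Affine independence in the Cayley embedding \<open>(A, 1, 0) \<union> (B, 0, 1)\<close>.\<close>

definition cayley_independent :: "plane set \<Rightarrow> plane set \<Rightarrow> bool" where
  "cayley_independent S S' \<longleftrightarrow>
     (\<forall>c c'. sum c S = 0 \<and> sum c' S' = 0 \<and> (\<Sum>a\<in>S. c a *\<^sub>R a) + (\<Sum>b\<in>S'. c' b *\<^sub>R b) = 0 \<longrightarrow>
        (\<forall>a\<in>S. c a = 0) \<and> (\<forall>b\<in>S'. c' b = 0))"

lemma cayley_independent_sym: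
  assumes "cayley_independent S S'"
  shows "cayley_independent S' S"
  unfolding cayley_independent_def
proof (intro allI impI)
  fix c c' assume "sum c S' = 0 \<and> sum c' S = 0 \<and> (\<Sum>a\<in>S'. c a *\<^sub>R a) + (\<Sum>b\<in>S. c' b *\<^sub>R b) = 0"
  then have "sum c' S = 0 \<and> sum c S' = 0 \<and> (\<Sum>b\<in>S. c' b *\<^sub>R b) + (\<Sum>a\<in>S'. c a *\<^sub>R a) = 0"
    by (simp add: add.commute)
  then show "(\<forall>a\<in>S'. c a = 0) \<and> (\<forall>b\<in>S. c' b = 0)"
    using assms[unfolded cayley_independent_def, rule_format, of c' c] by blast
qed

lemma cayley_independent_affine:
  assumes "cayley_independent S S'" "finite S"
  shows "\<not> affine_dependent S"
proof
  assume "affine_dependent S"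
  then obtain c where "sum c S = 0" "\<exists>v\<in>S. c v \<noteq> 0" "(\<Sum>v\<in>S. c v *\<^sub>R v) = 0"
    using affine_dependent_explicit_finite[OF assms(2)] by blast
  moreover from this have "(\<forall>a\<in>S. c a = 0) \<and> (\<forall>b\<in>S'. (0::real) = 0)"
    by (intro assms(1)[unfolded cayley_independent_def, rule_format]) simp
  ultimately show False
    by blast
qed

lemma span_differences_subset:
  fixes S :: "'a::real_vector set"
  assumes "finite S" "s \<in> S"
  shows "span ((\<lambda>a. a - s) ` S) \<subseteq> {\<Sum>a\<in>S. c a *\<^sub>R a | c. sum c S = 0}"
proof (rule span_minimal)
  show "(\<lambda>a. a - s) ` S \<subseteq> {\<Sum>a\<in>S. c a *\<^sub>R a | c. sum c S = 0}"
  proof safe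
    fix a assume "a \<in> S"
    define c where "c x = (if x = a then 1 else 0) - (if x = s then 1 else (0::real))" for x
    have "sum c S = 0" "(\<Sum>x\<in>S. c x *\<^sub>R x) = a - s"
      using assms \<open>a \<in> S\<close>
      by (simp_all add: c_def sum_subtractf scaleR_diff_left if_distrib[of "\<lambda>t. t *\<^sub>R _"] cong: if_cong)
    then show "\<exists>c. a - s = (\<Sum>a\<in>S. c a *\<^sub>R a) \<and> sum c S = 0"
      by metis
  qed
  show "subspace {\<Sum>a\<in>S. c a *\<^sub>R a | c. sum c S = (0::real)}"
    unfolding subspace_def
  proof (intro conjI ballI allI)
    show "0 \<in> {\<Sum>a\<in>S. c a *\<^sub>R a | c. sum c S = (0::real)}"
      by (auto intro!: exI[of _ "\<lambda>_. 0"])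
  next
    fix x y assume "x \<in> {\<Sum>a\<in>S. c a *\<^sub>R a | c. sum c S = (0::real)}"
        "y \<in> {\<Sum>a\<in>S. c a *\<^sub>R a | c. sum c S = (0::real)}"
    then obtain c d where "x = (\<Sum>a\<in>S. c a *\<^sub>R a)" "sum c S = 0" "y = (\<Sum>a\<in>S. d a *\<^sub>R a)" "sum d S = 0"
      by auto
    then show "x + y \<in> {\<Sum>a\<in>S. c a *\<^sub>R a | c. sum c S = (0::real)}"
      by (auto intro!: exI[of _ "\<lambda>a. c a + d a"] simp: scaleR_add_left sum.distrib)
  next
    fix r x assume "x \<in> {\<Sum>a\<in>S. c a *\<^sub>R a | c. sum c S = (0::real)}"
    then obtain c where "x = (\<Sum>a\<in>S. c a *\<^sub>R a)" "sum c S = 0"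
      by auto
    then show "r *\<^sub>R x \<in> {\<Sum>a\<in>S. c a *\<^sub>R a | c. sum c S = (0::real)}"
      by (auto intro!: exI[of _ "\<lambda>a. r * c a"] simp: scaleR_sum_right sum_distrib_left[symmetric])
  qed
qed

text \<open>A common vector of the two direction spaces would be a combination with coefficient sum
  0 on either side, hence an affine relation of the Cayley embedding. So the direction spaces meet
  in 0 only, and their dimensions add up to that of the Minkowski sum.\<close>

lemma aff_dim_cayley_independent:
  assumes ind: "cayley_independent S S'" and fin: "finite S" "finite S'" and "S \<noteq> {}" "S' \<noteq> {}"
  shows "aff_dim (S + S') = aff_dim S + aff_dim S'"
proof -
  obtain s s' where s: "s \<in> S" "s' \<in> S'"
    using assms by blast
  define U V where "U = span ((\<lambda>a. a - s) ` S)" and "V = span ((\<lambda>a. a - s') ` S')"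
  have "U \<inter> V \<subseteq> {0}"
  proof
    fix x assume "x \<in> U \<inter> V"
    then obtain c c' where "x = (\<Sum>a\<in>S. c a *\<^sub>R a)" "sum c S = 0" "x = (\<Sum>b\<in>S'. c' b *\<^sub>R b)" "sum c' S' = 0"
      using span_differences_subset[OF fin(1) s(1)] span_differences_subset[OF fin(2) s(2)]
      unfolding U_def V_def by blast
    then have "sum c S = 0 \<and> sum (\<lambda>b. - c' b) S' = 0 \<and> (\<Sum>a\<in>S. c a *\<^sub>R a) + (\<Sum>b\<in>S'. (- c' b) *\<^sub>R b) = 0"
      by (simp add: sum_negf)
    then have "\<forall>a\<in>S. c a = 0"
      using ind[unfolded cayley_independent_def, rule_format, of c "\<lambda>b. - c' b"] by blast
    then show "x \<in> {0}"
      using \<open>x = (\<Sum>a\<in>S. c a *\<^sub>R a)\<close> by simp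
  qed
  then have "dim (U \<inter> V) = 0"
    by (simp add: dim_eq_0)
  moreover have "subspace U" "subspace V"
    by (simp_all add: U_def V_def)
  ultimately have dimUV: "dim {x + y |x y. x \<in> U \<and> y \<in> V} = dim U + dim V"
    using dim_sums_Int[of U V] by linarith
  have subs: "subspace {x + y |x y. x \<in> U \<and> y \<in> V}"
    using \<open>subspace U\<close> \<open>subspace V\<close> by (rule subspace_sums)
  have "span ((\<lambda>x. x - (s + s')) ` (S + S')) = {x + y |x y. x \<in> U \<and> y \<in> V}"
  proof
    have "(a + b) - (s + s') \<in> {x + y |x y. x \<in> U \<and> y \<in> V}" if "a \<in> S" "b \<in> S'" for a b
    proof -
      have "a - s \<in> U" "b - s' \<in> V"
        using that by (auto simp: U_def V_def intro: span_base)
      moreover have "(a + b) - (s + s') = (a - s) + (b - s')"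
        by simp
      ultimately show ?thesis
        by blast
    qed
    then show "span ((\<lambda>x. x - (s + s')) ` (S + S')) \<subseteq> {x + y |x y. x \<in> U \<and> y \<in> V}"
      by (intro span_minimal subs) (auto simp: set_plus_def)
  next
    let ?W = "span ((\<lambda>x. x - (s + s')) ` (S + S'))"
    have "a - s \<in> ?W" if "a \<in> S" for a
    proof -
      have "(a + s') - (s + s') \<in> ?W"
        using that s by (intro span_base imageI set_plus_intro)
      then show ?thesis
        by simp
    qed
    then have U: "U \<subseteq> ?W"
      unfolding U_def by (intro span_minimal) auto
    have "b - s' \<in> ?W" if "b \<in> S'" for b
    proof -
      have "(s + b) - (s + s') \<in> ?W"
        using that s by (intro span_base imageI set_plus_intro)
      then show ?thesis
        by simp
    qed
    then have "V \<subseteq> ?W"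
      unfolding V_def by (intro span_minimal) auto
    then show "{x + y |x y. x \<in> U \<and> y \<in> V} \<subseteq> ?W"
      using U by (auto intro: span_add)
  qed
  then have "dim ((\<lambda>x. x - (s + s')) ` (S + S')) = dim U + dim V"
    using dimUV dim_span[of "(\<lambda>x. x - (s + s')) ` (S + S')"] by simp
  moreover have "s + s' \<in> affine hull (S + S')" "s \<in> affine hull S" "s' \<in> affine hull S'"
    using s by (auto intro: hull_inc set_plus_intro)
  ultimately show ?thesis
    using aff_dim_eq_dim_subtract[of "s + s'" "S + S'"] aff_dim_eq_dim_subtract[of s S]
      aff_dim_eq_dim_subtract[of s' S'] by (simp add: U_def V_def)
qed

section \<open>Plane sets of full dimension, and lower cells of Minkowski sums\<close>

lemma aff_dim_plane_noncollinear:
  fixes A :: "plane set"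
  assumes "\<not> collinear A"
  shows "aff_dim A = 2"
  using assms aff_dim_le_DIM[of A] by (simp add: collinear_aff_dim)

lemma interior_convex_hull_noncollinear:
  fixes A :: "plane set"
  assumes "\<not> collinear A"
  shows "interior (convex hull A) \<noteq> {}"
proof -
  have "A \<noteq> {}"
    using assms by auto
  moreover have "interior (convex hull A) = rel_interior (convex hull A)"
    using aff_dim_plane_noncollinear[OF assms] by (simp add: interior_rel_interior_gen aff_dim_convex_hull)
  ultimately show ?thesis
    by (simp add: rel_interior_eq_empty)
qed

lemma not_collinear_set_plus:
  fixes A B :: "plane set"
  assumes "\<not> collinear A" "B \<noteq> {}"
  shows "\<not> collinear (A + B)"
proof
  obtain b where "b \<in> B"
    using assms by blast
  then have "(+) b ` A \<subseteq> A + B"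
    by (auto simp: set_plus_def add.commute)
  moreover assume "collinear (A + B)"
  ultimately have "collinear ((+) b ` A)"
    by (rule collinear_subset[rotated])
  then show False
    using assms(1) by (simp add: collinear_aff_dim aff_dim_translation_eq)
qed

text \<open>With heights \<open>\<alpha> a + \<beta> b\<close> the objective is a sum of a function
  of a and a function of b, so it is minimal exactly if both summands are. This is why one gradient
  w selects the two summands of a mixed cell.\<close>

lemma minset_prod:
  assumes "finite A" "A \<noteq> {}" "finite B" "B \<noteq> {}"
  shows "minset (A \<times> B) (\<lambda>(a, b). a + b) (\<lambda>(a, b). \<alpha> a + \<beta> b) w = low A \<alpha> w \<times> low B \<beta> w"
proof -
  obtain a0 b0 where a0: "a0 \<in> low A \<alpha> w" and b0: "b0 \<in> low B \<beta> w"
    using minset_nonempty[OF assms(1,2), of "\<lambda>a. a" \<alpha> w] minset_nonempty[OF assms(3,4), of "\<lambda>a. a" \<beta> w]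
    by blast
  show ?thesis
  proof (intro equalityI subsetI)
    fix p assume p: "p \<in> minset (A \<times> B) (\<lambda>(a, b). a + b) (\<lambda>(a, b). \<alpha> a + \<beta> b) w"
    obtain a b where [simp]: "p = (a, b)"
      by fastforce
    have ab: "a \<in> A" "b \<in> B" and le: "\<And>a' b'. a' \<in> A \<Longrightarrow> b' \<in> B \<Longrightarrow>
        w \<bullet> a + \<alpha> a + (w \<bullet> b + \<beta> b) \<le> w \<bullet> a' + \<alpha> a' + (w \<bullet> b' + \<beta> b')"
      using p by (auto simp: minset_def inner_add_right algebra_simps)
    have "w \<bullet> a + \<alpha> a \<le> w \<bullet> a' + \<alpha> a'" if "a' \<in> A" for a'
      using le[OF that ab(2)] by simp
    moreover have "w \<bullet> b + \<beta> b \<le> w \<bullet> b' + \<beta> b'" if "b' \<in> B" for b'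
      using le[OF ab(1) that] by simp
    ultimately show "p \<in> low A \<alpha> w \<times> low B \<beta> w"
      using ab by (simp add: minset_def)
  next
    fix p assume "p \<in> low A \<alpha> w \<times> low B \<beta> w"
    then obtain a b where [simp]: "p = (a, b)" and ab: "a \<in> low A \<alpha> w" "b \<in> low B \<beta> w"
      by auto
    have "w \<bullet> (a + b) + (\<alpha> a + \<beta> b) \<le> w \<bullet> (a' + b') + (\<alpha> a' + \<beta> b')" if "a' \<in> A" "b' \<in> B" for a' b'
    proof -
      have "w \<bullet> a + \<alpha> a \<le> w \<bullet> a' + \<alpha> a'" "w \<bullet> b + \<beta> b \<le> w \<bullet> b' + \<beta> b'"
        using ab that by (auto simp: minset_def)
      then show ?thesis
        by (simp add: inner_add_right)
    qed
    then show "p \<in> minset (A \<times> B) (\<lambda>(a, b). a + b) (\<lambda>(a, b). \<alpha> a + \<beta> b) w"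
      using ab by (auto simp: minset_def)
  qed
qed

lemma cell_prod:
  assumes "finite A" "A \<noteq> {}" "finite B" "B \<noteq> {}"
  shows "cell (A \<times> B) (\<lambda>(a, b). a + b) (\<lambda>(a, b). \<alpha> a + \<beta> b) w = low_cell A \<alpha> w + low_cell B \<beta> w"
proof -
  have "(\<lambda>(a, b). a + b) ` (low A \<alpha> w \<times> low B \<beta> w) = low A \<alpha> w + low B \<beta> w"
    by (rule set_plus_image[symmetric])
  then show ?thesis
    by (simp add: cell_def minset_prod[OF assms] convex_hull_set_plus)
qed

lemma low_cell_simplex:
  assumes "finite A" "A \<noteq> {}" "\<not> affine_dependent (low A \<alpha> w)"
  shows "int (card (low A \<alpha> w) - 1) simplex low_cell A \<alpha> w"
    and "aff_dim (low A \<alpha> w) = int (card (low A \<alpha> w) - 1)"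
proof -
  have "finite (low A \<alpha> w)" "low A \<alpha> w \<noteq> {}"
    using assms minset_nonempty finite_subset[OF minset_subset] by blast+
  then have "card (low A \<alpha> w) > 0"
    by (simp add: card_gt_0_iff)
  then have *: "int (card (low A \<alpha> w)) = int (card (low A \<alpha> w) - 1) + 1"
    by simp
  then show "int (card (low A \<alpha> w) - 1) simplex low_cell A \<alpha> w"
    unfolding simplex_def cell_def image_ident using assms(3) by blast
  show "aff_dim (low A \<alpha> w) = int (card (low A \<alpha> w) - 1)"
    using aff_dim_affine_independent[OF assms(3)] * by linarith
qed

text \<open>Affinely independent minimizers turn every cell into a simplex, and the last hypothesis
  makes every point of A a cell of its own. The empty set is added because it is a face of every
  simplex.\<close>

lemma triangulation_of_low_cells:
  assumes "finite A" and nc: "\<not> collinear A"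
    and ind: "\<And>w. \<not> affine_dependent (low A \<alpha> w)"
    and vertex: "\<And>a. a \<in> A \<Longrightarrow> \<exists>w. low A \<alpha> w = {a}"
  shows "triangulation_of A (insert {} (range (low_cell A \<alpha>)))"
proof -
  have "A \<noteq> {}"
    using nc by auto
  have sub: "polygonal_subdivision (convex hull A) (range (low_cell A \<alpha>))"
    using polygonal_subdivision_cells[OF assms(1) \<open>A \<noteq> {}\<close>, of "\<lambda>a. a" \<alpha>]
      interior_convex_hull_noncollinear[OF nc] by simp
  have "simplicial_complex (insert {} (range (low_cell A \<alpha>)))"
    unfolding simplicial_complex_def
  proof (intro conjI ballI allI impI)
    show "finite (insert {} (range (low_cell A \<alpha>)))"
      using finite_cells[OF assms(1)] by blast
  next
    fix S assume "S \<in> insert {} (range (low_cell A \<alpha>))"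
    then consider "S = {}" | w where "S = low_cell A \<alpha> w"
      by blast
    then show "\<exists>n. n simplex S"
    proof cases
      case 1
      then show ?thesis
        by (auto simp: simplex_def intro!: exI[of _ "-1"] exI[of _ "{}"])
    next
      case 2
      then show ?thesis
        using low_cell_simplex(1)[OF assms(1) \<open>A \<noteq> {}\<close> ind] by blast
    qed
  next
    fix F S assume "S \<in> insert {} (range (low_cell A \<alpha>)) \<and> F face_of S"
    then show "F \<in> insert {} (range (low_cell A \<alpha>))"
      using sub unfolding polygonal_subdivision_def by (metis face_of_empty insert_iff)
  next
    fix S S' assume "S \<in> insert {} (range (low_cell A \<alpha>)) \<and> S' \<in> insert {} (range (low_cell A \<alpha>))"
    then show "(S \<inter> S') face_of S"
      using sub unfolding polygonal_subdivision_def
      by (metis Int_empty_left Int_empty_right empty_face_of insert_iff)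
  qed
  moreover have "\<Union>(insert {} (range (low_cell A \<alpha>))) = convex hull A"
    using sub unfolding polygonal_subdivision_def by simp
  moreover have "{v. {v} \<in> insert {} (range (low_cell A \<alpha>))} = A"
  proof (intro equalityI subsetI)
    fix v assume "v \<in> {v. {v} \<in> insert {} (range (low_cell A \<alpha>))}"
    then obtain w where w: "{v} = low_cell A \<alpha> w"
      by blast
    have "low A \<alpha> w \<subseteq> {v}"
      unfolding w cell_def by (simp add: hull_subset)
    then show "v \<in> A"
      using minset_nonempty[OF assms(1) \<open>A \<noteq> {}\<close>, of "\<lambda>a. a" \<alpha> w]
        minset_subset[of A "\<lambda>a. a" \<alpha> w] by blast
  next
    fix a assume "a \<in> A"
    then obtain w where "low A \<alpha> w = {a}"
      using vertex[OF \<open>a \<in> A\<close>] by blast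
    then have "low_cell A \<alpha> w = {a}"
      by (simp add: cell_def)
    then show "a \<in> {v. {v} \<in> insert {} (range (low_cell A \<alpha>))}"
      by (metis insertI2 mem_Collect_eq rangeI)
  qed
  ultimately show ?thesis
    by (simp add: triangulation_of_def)
qed

text \<open>The heights over three affinely independent points determine the gradient of the affine
  function through them: the difference of two such gradients is constant on the whole plane, hence
  0.\<close>

lemma triangle_low_cell:
  assumes "finite A" "A \<noteq> {}" and ind: "\<And>w. \<not> affine_dependent (low A \<alpha> w)"
    and F: "F \<in> triangles (insert {} (range (low_cell A \<alpha>)))"
  obtains w where "F = low_cell A \<alpha> w" "card (low A \<alpha> w) = 3"
    "\<And>v. low_cell A \<alpha> v = F \<Longrightarrow> v = w"
proof -
  have "F \<noteq> {}"
    using F by (auto simp: triangles_def simplex_empty)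
  then obtain w where w: "F = low_cell A \<alpha> w"
    using F by (auto simp: triangles_def)
  have "aff_dim F = 2"
    using F by (auto simp: triangles_def dest: aff_dim_simplex)
  then have dim: "aff_dim (low A \<alpha> w) = 2"
    by (simp add: w cell_def aff_dim_convex_hull)
  then have "card (low A \<alpha> w) = 3"
    using low_cell_simplex(2)[OF assms(1,2) ind, of w] by simp
  moreover have "v = w" if "low_cell A \<alpha> v = F" for v
  proof -
    have eq: "low A \<alpha> v = low A \<alpha> w"
      using that minset_eq_iff_cell_eq[OF assms(1)] w by metis
    obtain a0 where a0: "a0 \<in> low A \<alpha> w"
      using minset_nonempty[OF assms(1,2), of "\<lambda>a. a" \<alpha> w] by blast
    have "low A \<alpha> w \<subseteq> {x. (v - w) \<bullet> x = (v - w) \<bullet> a0}"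
    proof
      fix a assume a: "a \<in> low A \<alpha> w"
      have "w \<bullet> a + \<alpha> a = w \<bullet> a0 + \<alpha> a0"
        using minset_value[OF a0] a by blast
      moreover have "v \<bullet> a + \<alpha> a = v \<bullet> a0 + \<alpha> a0"
        using minset_value[of a0 A "\<lambda>a. a" \<alpha> v] a a0 eq by blast
      ultimately show "a \<in> {x. (v - w) \<bullet> x = (v - w) \<bullet> a0}"
        by (simp add: inner_diff_left)
    qed
    then have "affine hull (low A \<alpha> w) \<subseteq> {x. (v - w) \<bullet> x = (v - w) \<bullet> a0}"
      by (intro hull_minimal) (auto simp: affine_hyperplane)
    moreover have "affine hull (low A \<alpha> w) = UNIV"
      using dim aff_dim_eq_full[of "low A \<alpha> w"] by simp
    ultimately have "(v - w) \<bullet> (a0 + (v - w)) = (v - w) \<bullet> a0"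
      by blast
    then show "v = w"
      by (simp add: inner_add_right)
  qed
  ultimately show ?thesis
    using that w by blast
qed

text \<open>Independence makes the dimensions of the two summands add up to at most 2. So a triangle
  of one side leaves a single point for the other, and since a triangle has only one gradient w,
  that point is unique.\<close>

lemma mixed_subdivision_low_cells:
  assumes fin: "finite A" "finite B" and nc: "\<not> collinear A" "\<not> collinear B"
    and cay: "\<And>w. cayley_independent (low A \<alpha> w) (low B \<beta> w)"
  shows "mixed_subdivision A B (insert {} (range (low_cell A \<alpha>))) (insert {} (range (low_cell B \<beta>)))
           (range (\<lambda>w. (low_cell A \<alpha> w, low_cell B \<beta> w)))"
proof -
  define M where "M = range (\<lambda>w. (low_cell A \<alpha> w, low_cell B \<beta> w))"
  have ne: "A \<noteq> {}" "B \<noteq> {}"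
    using nc by auto
  have finl: "finite (low A \<alpha> w)" "finite (low B \<beta> w)" for w
    using fin finite_subset[OF minset_subset] by blast+
  have nel: "low A \<alpha> w \<noteq> {}" "low B \<beta> w \<noteq> {}" for w
    using fin ne minset_nonempty by blast+
  have indA: "\<not> affine_dependent (low A \<alpha> w)" for w
    using cayley_independent_affine[OF cay finl(1)] .
  have indB: "\<not> affine_dependent (low B \<beta> w)" for w
    using cayley_independent_affine[OF cayley_independent_sym[OF cay] finl(2)] .
  note dims = low_cell_simplex(2)[OF fin(1) ne(1) indA] low_cell_simplex(2)[OF fin(2) ne(2) indB]
  have dim: "aff_dim (low_cell A \<alpha> w + low_cell B \<beta> w) = int (card (low A \<alpha> w) - 1 + (card (low B \<beta> w) - 1))" for w
    using aff_dim_cayley_independent[OF cay finl nel] dims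
    by (simp add: cell_def aff_dim_convex_hull flip: convex_hull_set_plus)
  have single: "\<exists>b. low B \<beta> w = {b}" if "card (low A \<alpha> w) = 3" for w
  proof -
    have "card (low B \<beta> w) - 1 = 0"
      using dim[of w] aff_dim_le_DIM[of "low_cell A \<alpha> w + low_cell B \<beta> w"] that by simp
    then have "card (low B \<beta> w) = 1"
      using nel finl by (metis One_nat_def Suc_diff_1 card_gt_0_iff)
    then show ?thesis
      by (simp add: card_1_singleton_iff)
  qed
  have single': "\<exists>a. low A \<alpha> w = {a}" if "card (low B \<beta> w) = 3" for w
  proof -
    have "card (low A \<alpha> w) - 1 = 0"
      using dim[of w] aff_dim_le_DIM[of "low_cell A \<alpha> w + low_cell B \<beta> w"] that by simp
    then have "card (low A \<alpha> w) = 1"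
      using nel finl by (metis One_nat_def Suc_diff_1 card_gt_0_iff)
    then show ?thesis
      by (simp add: card_1_singleton_iff)
  qed
  let ?x = "\<lambda>(a, b). a + b :: plane" and ?h = "\<lambda>(a, b). \<alpha> a + \<beta> b"
  have AB: "finite (A \<times> B)" "A \<times> B \<noteq> {}"
    using fin ne by auto
  have img: "(\<lambda>(F, G). F + G) ` M = range (cell (A \<times> B) ?x ?h)"
    by (simp add: M_def image_image cell_prod[OF fin(1) ne(1) fin(2) ne(2)])
  have "?x ` (A \<times> B) = A + B"
    by (rule set_plus_image[symmetric])
  then have poly: "polygonal_subdivision (convex hull (A + B)) ((\<lambda>(F, G). F + G) ` M)"
    using polygonal_subdivision_cells[OF AB, of ?x ?h] img
      interior_convex_hull_noncollinear[OF not_collinear_set_plus[OF nc(1) ne(2)]] by simp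
  have inj: "inj_on (\<lambda>(F, G). F + G) M"
  proof (rule inj_onI)
    fix p q assume "p \<in> M" "q \<in> M" and eq: "(case p of (F, G) \<Rightarrow> F + G) = (case q of (F, G) \<Rightarrow> F + G)"
    then obtain w v where p: "p = (low_cell A \<alpha> w, low_cell B \<beta> w)" and q: "q = (low_cell A \<alpha> v, low_cell B \<beta> v)"
      by (auto simp: M_def)
    have "cell (A \<times> B) ?x ?h w = cell (A \<times> B) ?x ?h v"
      using eq by (simp add: p q cell_prod[OF fin(1) ne(1) fin(2) ne(2)])
    then have "low A \<alpha> w \<times> low B \<beta> w = low A \<alpha> v \<times> low B \<beta> v"
      using minset_eq_iff_cell_eq[OF AB(1), of ?x ?h w v]
      by (simp add: minset_prod[OF fin(1) ne(1) fin(2) ne(2)])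
    then have "low A \<alpha> w = low A \<alpha> v" "low B \<beta> w = low B \<beta> v"
      using nel by (auto simp: times_eq_iff)
    then show "p = q"
      by (simp add: p q cell_def)
  qed
  have mem: "F \<in> insert {} (range (low_cell A \<alpha>)) \<and> G \<in> insert {} (range (low_cell B \<beta>)) \<and>
      (\<exists>i j :: nat. int i simplex F \<and> int j simplex G \<and> aff_dim (F + G) = int (i + j))"
    if FG: "(F, G) \<in> M" for F G
  proof -
    obtain w where [simp]: "F = low_cell A \<alpha> w" "G = low_cell B \<beta> w"
      using FG by (auto simp: M_def)
    show ?thesis
      using low_cell_simplex(1)[OF fin(1) ne(1) indA] low_cell_simplex(1)[OF fin(2) ne(2) indB] dim
      by (metis \<open>F = low_cell A \<alpha> w\<close> \<open>G = low_cell B \<beta> w\<close> insertI2 rangeI)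
  qed
  have unique_b: "\<exists>!b. b \<in> B \<and> (F, {b}) \<in> M" if F: "F \<in> triangles (insert {} (range (low_cell A \<alpha>)))" for F
  proof -
    obtain w where w: "F = low_cell A \<alpha> w" "card (low A \<alpha> w) = 3" and uniq: "\<And>v. low_cell A \<alpha> v = F \<Longrightarrow> v = w"
      using triangle_low_cell[OF fin(1) ne(1) indA F] by metis
    obtain b where b: "low B \<beta> w = {b}"
      using single[OF w(2)] by blast
    have cb: "low_cell B \<beta> w = {b}"
      by (simp add: cell_def b)
    show ?thesis
    proof (rule ex1I[of _ b])
      have "b \<in> B"
        using b minset_subset by fast
      then show "b \<in> B \<and> (F, {b}) \<in> M"
        unfolding M_def w(1) cb[symmetric] by blast
    next
      fix b' assume "b' \<in> B \<and> (F, {b'}) \<in> M"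
      then obtain v where "F = low_cell A \<alpha> v" "{b'} = low_cell B \<beta> v"
        by (auto simp: M_def)
      then show "b' = b"
        using uniq cb by force
    qed
  qed
  have unique_a: "\<exists>!a. a \<in> A \<and> ({a}, G) \<in> M" if G: "G \<in> triangles (insert {} (range (low_cell B \<beta>)))" for G
  proof -
    obtain w where w: "G = low_cell B \<beta> w" "card (low B \<beta> w) = 3" and uniq: "\<And>v. low_cell B \<beta> v = G \<Longrightarrow> v = w"
      using triangle_low_cell[OF fin(2) ne(2) indB G] by metis
    obtain a where a: "low A \<alpha> w = {a}"
      using single'[OF w(2)] by blast
    have ca: "low_cell A \<alpha> w = {a}"
      by (simp add: cell_def a)
    show ?thesis
    proof (rule ex1I[of _ a])
      have "a \<in> A"
        using a minset_subset by fast
      then show "a \<in> A \<and> ({a}, G) \<in> M"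
        unfolding M_def w(1) ca[symmetric] by blast
    next
      fix a' assume "a' \<in> A \<and> ({a'}, G) \<in> M"
      then obtain v where "{a'} = low_cell A \<alpha> v" "G = low_cell B \<beta> v"
        by (auto simp: M_def)
      then show "a' = a"
        using uniq ca by force
    qed
  qed
  show ?thesis
    unfolding mixed_subdivision_def M_def[symmetric]
  proof (intro conjI ballI)
    show "case p of (F, G) \<Rightarrow> F \<in> insert {} (range (low_cell A \<alpha>)) \<and> G \<in> insert {} (range (low_cell B \<beta>)) \<and>
        (\<exists>i j :: nat. int i simplex F \<and> int j simplex G \<and> aff_dim (F + G) = int (i + j))"
      if "p \<in> M" for p
      using mem[of "fst p" "snd p"] that by (simp add: case_prod_beta)
  qed (rule poly inj | erule unique_a unique_b)+
qed

lemma parallelogram_low_cells: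
  assumes fin: "finite A" "finite B" and nc: "\<not> collinear A" "\<not> collinear B"
    and cay: "cayley_independent (low A \<alpha> w) (low B \<beta> w)"
    and "low A \<alpha> w = {a, a'}" "a \<noteq> a'" "low B \<beta> w = {b, b'}" "b \<noteq> b'"
  shows "(convex hull {a, a'}, convex hull {b, b'}) \<in>
    parallelograms (range (\<lambda>w. (low_cell A \<alpha> w, low_cell B \<beta> w)))"
proof -
  have cells: "low_cell A \<alpha> w = convex hull {a, a'}" "low_cell B \<beta> w = convex hull {b, b'}"
    using assms by (simp_all add: cell_def)
  have simp1: "1 simplex (convex hull {a, a'})" "1 simplex (convex hull {b, b'})"
    unfolding simplex_def using \<open>a \<noteq> a'\<close> \<open>b \<noteq> b'\<close>
    by (intro exI[of _ "{a, a'}"] exI[of _ "{b, b'}"]; simp)+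
  have "aff_dim (convex hull {a, a'} + convex hull {b, b'}) = aff_dim ({a, a'} + {b, b'})"
    by (simp add: aff_dim_convex_hull flip: convex_hull_set_plus)
  also have "\<dots> = aff_dim {a, a'} + aff_dim {b, b'}"
    using cay assms by (intro aff_dim_cayley_independent) auto
  also have "\<dots> = 2"
    using \<open>a \<noteq> a'\<close> \<open>b \<noteq> b'\<close> by (simp add: aff_dim_2)
  finally show ?thesis
    unfolding parallelograms_def using simp1 cells[symmetric] by auto
qed

section \<open>Crossing normal rays\<close>

definition cut_size :: "real \<Rightarrow> real \<Rightarrow> real \<Rightarrow> real \<Rightarrow> real" where
  "cut_size n m x y = x * (m - y) + y * (n - x)"

text \<open>For \<open>p = x (m - y)\<close> and \<open>q = y (n - x)\<close> one has
  \<open>(p + q)^2 >= 4 p q\<close>, and p q regroups into \<open>x (n - x)\<close> times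
  \<open>y (m - y)\<close>.\<close>

lemma cut_size_ge_amgm:
  assumes "0 \<le> x" "x \<le> n" "0 \<le> y" "y \<le> m" "2 \<le> n" "2 \<le> m"
    and "x * (n - x) \<ge> 2 * (n - 2)" "y * (m - y) \<ge> 2 * (m - 2)"
  shows "cut_size n m x y \<ge> 4 * sqrt ((n - 2) * (m - 2))"
proof -
  have "16 * ((n - 2) * (m - 2)) = 4 * ((2 * (n - 2)) * (2 * (m - 2)))"
    by (simp add: algebra_simps)
  also have "\<dots> \<le> 4 * ((x * (n - x)) * (y * (m - y)))"
    by (rule mult_left_mono, rule mult_mono) (use assms in auto)
  also have "\<dots> = 4 * ((x * (m - y)) * (y * (n - x)))"
    by simp
  also have "\<dots> \<le> (cut_size n m x y)\<^sup>2"
    using zero_le_power2[of "x * (m - y) - y * (n - x)"]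
    by (simp add: cut_size_def power2_eq_square algebra_simps)
  finally have "16 * ((n - 2) * (m - 2)) \<le> (cut_size n m x y)\<^sup>2" .
  moreover have "0 \<le> cut_size n m x y"
    using assms by (simp add: cut_size_def)
  ultimately have "sqrt (16 * ((n - 2) * (m - 2))) \<le> cut_size n m x y"
    using real_le_lsqrt by blast
  then show ?thesis
    by (simp add: real_sqrt_mult)
qed

text \<open>Twice the cut size is \<open>n m - (2 x - n) (2 y - m)\<close>. So if the interval holds
  at least half of one kind and at most half of the other, the cut size is at least n m / 2, and
  \<open>n^2 >= 8 (n - 2)\<close> because \<open>(n - 4)^2 >= 0\<close>.\<close>

lemma cut_size_ge_half:
  assumes "2 \<le> n" "2 \<le> m" and "(2 * x - n) * (2 * y - m) \<le> 0"
  shows "cut_size n m x y \<ge> 4 * sqrt ((n - 2) * (m - 2))"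
proof -
  have *: "8 * (k - 2) \<le> k\<^sup>2" for k :: real
    using zero_le_power2[of "k - 4"] by (simp add: power2_eq_square algebra_simps)
  have "64 * ((n - 2) * (m - 2)) = (8 * (n - 2)) * (8 * (m - 2))"
    by (simp add: algebra_simps)
  also have "\<dots> \<le> n\<^sup>2 * m\<^sup>2"
    using assms * by (intro mult_mono) auto
  finally have "sqrt (64 * ((n - 2) * (m - 2))) \<le> n * m"
    using assms by (intro real_le_lsqrt) (auto simp: power_mult_distrib)
  then have "8 * sqrt ((n - 2) * (m - 2)) \<le> n * m"
    by (simp add: real_sqrt_mult)
  moreover have "2 * cut_size n m x y = n * m - (2 * x - n) * (2 * y - m)"
    by (simp add: cut_size_def algebra_simps)
  ultimately show ?thesis
    using assms(3) by linarith
qed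

lemma cut_size_sym: "cut_size n m x y = cut_size m n y x"
  by (simp add: cut_size_def)

lemma mult_diff_ge:
  fixes x n :: nat
  assumes "2 \<le> x" "x + 2 \<le> n"
  shows "real x * (real n - real x) \<ge> 2 * (real n - 2)"
proof -
  have "(real x - 2) * (real n - real x - 2) \<ge> 0"
    using assms by (intro mult_nonneg_nonneg) auto
  then show ?thesis
    by (simp add: algebra_simps)
qed

text \<open>For n = 3 no x satisfies \<open>2 <= x <= n - 2\<close>, yet x = 1 and x = 2 give
  equality in the required estimate.\<close>

lemma mult_diff_ge_3:
  fixes x :: nat
  assumes "1 \<le> x" "x \<le> 2"
  shows "real x * (real 3 - real x) \<ge> 2 * (real 3 - 2)"
  using assms by (cases "x = 1") (auto simp: not_less_eq_eq numeral_2_eq_2 le_Suc_eq)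

text \<open>The three parts come from cutting a cyclically ordered set of lines just before and just
  after a median line.\<close>

lemma cut_size_parts_single:
  fixes XP XQ YP YD YQ n m :: nat
  assumes n: "n = XP + 1 + XQ" and m: "m = YP + YD + YQ"
    and "3 \<le> n" "3 \<le> m" and YD: "YD + 2 \<le> m" and "1 \<le> YD"
    and "2 * XP < n" "2 * XQ < n" "2 * YP < m" "2 * YQ < m"
  shows "\<exists>(x, y) \<in> {(1, YD), (XP, YP), (XQ, YQ)}.
           cut_size n m (real x) (real y) \<ge> 4 * sqrt ((real n - 2) * (real m - 2))"
proof -
  \<comment> \<open>Neither outer part reaches half of the edges and only one edge lies between
    them, so the outer parts are equal and n is odd.\<close>
  have XPQ: "XP = XQ"
    using assms by linarith
  have good: ?thesis if "(x, y) \<in> {(1, YD), (XP, YP), (XQ, YQ)}"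
      "real x * (real n - real x) \<ge> 2 * (real n - 2)" "real y * (real m - real y) \<ge> 2 * (real m - 2)" for x y
  proof -
    have "x \<le> n" "y \<le> m"
      using that(1) n m by auto
    then have "cut_size n m (real x) (real y) \<ge> 4 * sqrt ((real n - 2) * (real m - 2))"
      using that assms(3,4) by (intro cut_size_ge_amgm) auto
    then show ?thesis
      using that(1) by blast
  qed
  show ?thesis
  proof (cases "n = 3")
    case True
    then have X: "XP = 1" "XQ = 1"
      using XPQ n by auto
    have gx: "real (Suc 0) * (real n - real (Suc 0)) \<ge> 2 * (real n - 2)"
      using True by simp
    consider "m = 3" | "m \<noteq> 3" "2 \<le> YD" | "m \<noteq> 3" "YD = 1"
      using \<open>1 \<le> YD\<close> by linarith
    then show ?thesis
    proof cases
      case 1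
      then show ?thesis
        using good[of 1 YD] gx mult_diff_ge_3[of YD] YD \<open>1 \<le> YD\<close> by auto
    next
      case 2
      then show ?thesis
        using good[of 1 YD] gx mult_diff_ge[of YD m] YD by auto
    next
      case 3
      \<comment> \<open>Here the middle part is a single edge for m as well; thus m is odd and, not
        being 3, at least 5.\<close>
      then have "2 \<le> YP" "YP + 2 \<le> m"
        using assms by linarith+
      then show ?thesis
        using good[of 1 YP] gx X mult_diff_ge[of YP m] by auto
    qed
  next
    case False
    have X: "2 \<le> XP" "XP + 2 \<le> n"
      using False XPQ n \<open>3 \<le> n\<close> by auto
    have gx: "real XP * (real n - real XP) \<ge> 2 * (real n - 2)"
      by (rule mult_diff_ge[OF X])
    consider "2 \<le> YP" | "2 \<le> YQ" | "YP \<le> 1" "YQ \<le> 1"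
      by linarith
    then show ?thesis
    proof cases
      case 1
      then show ?thesis
        using gx mult_diff_ge[of YP m] assms(9) by (intro good[of XP YP]) auto
    next
      case 2
      then show ?thesis
        using gx XPQ mult_diff_ge[of YQ m] assms(10) by (intro good[of XQ YQ]) auto
    next
      case 3
      \<comment> \<open>The outer parts together hold \<open>m - YD >= 2\<close> edges, so each of
        them holds exactly one.\<close>
      then have Y: "YP = 1" "YQ = 1" "YD = m - 2"
        using m YD by auto
      show ?thesis
      proof (cases "m = 3")
        case True
        then show ?thesis
          using good[of XP YP] gx Y mult_diff_ge_3[of YP] by auto
      next
        case False
        define q r where "q = real n - 2" and "r = real m - 2"
        have qr: "q \<ge> 0" "r \<ge> 2"
          using False \<open>3 \<le> m\<close> \<open>3 \<le> n\<close> by (auto simp: q_def r_def)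
        \<comment> \<open>The inequality of the means does not help here, since
          \<open>1 * (n - 1)\<close> is less than \<open>2 (n - 2)\<close>. The direct value
          \<open>q r + r + 2\<close> is at least \<open>q r + 4\<close>, which exceeds
          \<open>4 sqrt (q r)\<close> by a square.\<close>
        have "cut_size n m (real 1) (real YD) = 2 + r * (q + 1)"
          using Y \<open>3 \<le> m\<close> by (simp add: cut_size_def q_def r_def of_nat_diff)
        moreover have "0 \<le> (sqrt (q * r) - 2)\<^sup>2"
          by simp
        then have "4 * sqrt (q * r) \<le> q * r + 4"
          using qr by (simp add: power2_eq_square algebra_simps)
        ultimately have "cut_size n m (real 1) (real YD) \<ge> 4 * sqrt (q * r)"
          using qr by (simp add: algebra_simps)
        then show ?thesis
          unfolding q_def r_def by blast
      qed
    qed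
  qed
qed

text \<open>If the first two parts together hold a majority of one kind only, the half estimate
  applies to them. Otherwise they hold majorities of both kinds, so the middle part contains edges
  of both kinds: with at least two of each it is itself a good interval, and a single edge of either
  kind is the case treated before.\<close>

lemma cut_size_parts:
  fixes XP XD XQ YP YD YQ n m :: nat
  assumes n: "n = XP + XD + XQ" and m: "m = YP + YD + YQ"
    and "3 \<le> n" "3 \<le> m" and XD: "XD + 2 \<le> n" and YD: "YD + 2 \<le> m"
    and P: "2 * XP < n" "2 * YP < m" and Q: "n \<le> 2 * (XP + XD) \<or> m \<le> 2 * (YP + YD)"
  shows "\<exists>(x, y) \<in> {(XP + XD, YP + YD), (XD, YD), (XP, YP), (XQ, YQ)}.
           cut_size n m (real x) (real y) \<ge> 4 * sqrt ((real n - 2) * (real m - 2))"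
proof (cases "(2 * real (XP + XD) - n) * (2 * real (YP + YD) - m) \<le> 0")
  case True
  then have "cut_size n m (real (XP + XD)) (real (YP + YD)) \<ge> 4 * sqrt ((real n - 2) * (real m - 2))"
    using assms by (intro cut_size_ge_half) auto
  then show ?thesis
    by blast
next
  case False
  then have "(2 * real (XP + XD) - n > 0 \<and> 2 * real (YP + YD) - m > 0) \<or>
      (2 * real (XP + XD) - n < 0 \<and> 2 * real (YP + YD) - m < 0)"
    by (simp add: not_le zero_less_mult_iff)
  \<comment> \<open>The median hypothesis \<open>Q\<close> excludes that both differences are
    negative.\<close>
  then have gt: "2 * (XP + XD) > n" "2 * (YP + YD) > m"
    using Q by linarith+
  then have Q': "2 * XQ < n" "2 * YQ < m" and D: "1 \<le> XD" "1 \<le> YD"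
    using n m P by simp_all
  consider "2 \<le> XD" "2 \<le> YD" | "XD = 1" | "YD = 1"
    using D by linarith
  then show ?thesis
  proof cases
    case 1
    then have "cut_size n m (real XD) (real YD) \<ge> 4 * sqrt ((real n - 2) * (real m - 2))"
      using XD YD by (intro cut_size_ge_amgm mult_diff_ge) auto
    then show ?thesis
      by blast
  next
    case 2
    then have "\<exists>(x, y) \<in> {(1, YD), (XP, YP), (XQ, YQ)}.
           cut_size n m (real x) (real y) \<ge> 4 * sqrt ((real n - 2) * (real m - 2))"
      using assms Q' D by (intro cut_size_parts_single) auto
    then show ?thesis
      using 2 by auto
  next
    case 3
    then have "\<exists>(y, x) \<in> {(1, XD), (YP, XP), (YQ, XQ)}.
           cut_size m n (real y) (real x) \<ge> 4 * sqrt ((real m - 2) * (real n - 2))"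
      using assms Q' D by (intro cut_size_parts_single) auto
    then show ?thesis
      using 3 cut_size_sym[of m n] by (auto simp: mult.commute)
  qed
qed

section \<open>Crossings counted over intervals of slopes\<close>

definition crs :: "plane \<Rightarrow> plane \<Rightarrow> real" where
  "crs u v = u$1 * v$2 - u$2 * v$1"

text \<open>A shear that makes no given direction vertical. It gives all edges finite slopes, and
  later it makes a linear function injective on a finite point set.\<close>

lemma finite_ex_shear:
  fixes D :: "plane set"
  assumes "finite D" "0 \<notin> D"
  obtains \<rho> where "\<And>d. d \<in> D \<Longrightarrow> d$1 + \<rho> * d$2 \<noteq> 0"
proof -
  have "finite ((\<lambda>d. - d$1 / d$2) ` D)"
    using assms by simp
  then obtain \<rho> where \<rho>: "\<rho> \<notin> (\<lambda>d. - d$1 / d$2) ` D"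
    using ex_new_if_finite infinite_UNIV_char_0 by blast
  show ?thesis
  proof (rule that[of \<rho>])
    fix d assume "d \<in> D"
    then have "d \<noteq> 0" "\<rho> \<noteq> - d$1 / d$2"
      using assms \<rho> by auto
    then show "d$1 + \<rho> * d$2 \<noteq> 0"
      by (cases "d$2 = 0") (auto simp: vec_eq_iff forall_2 field_simps)
  qed
qed

text \<open>Pairs of edge vectors whose normal rays, drawn from two apexes that differ by the rotated
  \<open>v\<close>, cross each other.\<close>

definition crossings :: "'e set \<Rightarrow> ('e \<Rightarrow> plane) \<Rightarrow> 'f set \<Rightarrow> ('f \<Rightarrow> plane) \<Rightarrow> plane \<Rightarrow> ('e \<times> 'f) set" where
  "crossings E a F b v =
     {(e, f) \<in> E \<times> F. crs (b f) (a e) * crs v (a e) > 0 \<and> crs (b f) (a e) * crs v (b f) > 0}"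

text \<open>If \<open>crs v\<close> has the same sign on both edge vectors, this common sign agrees
  with that of \<open>crs (b f) (a e)\<close> either for v or for its negative, never for both. So
  each such pair crosses for exactly one of the two directions.\<close>

lemma card_crossings_uminus:
  assumes "finite E" "finite F"
  shows "card {(e, f) \<in> E \<times> F. crs (b f) (a e) \<noteq> 0 \<and> crs v (a e) * crs v (b f) > 0}
       = card (crossings E a F b v) + card (crossings E a F b (- v))"
proof -
  have neg: "crs (- v) x = - crs v x" for x
    by (simp add: crs_def)
  have "{(e, f) \<in> E \<times> F. crs (b f) (a e) \<noteq> 0 \<and> crs v (a e) * crs v (b f) > 0}
      = crossings E a F b v \<union> crossings E a F b (- v)"
    unfolding crossings_def neg by (auto simp: zero_less_mult_iff mult_less_0_iff)
  moreover have "crossings E a F b v \<inter> crossings E a F b (- v) = {}"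
    unfolding crossings_def neg by auto
  moreover have "finite (crossings E a F b w)" for w
    unfolding crossings_def using assms by (auto intro: finite_subset[of _ "E \<times> F"])
  ultimately show ?thesis
    by (simp add: card_Un_disjoint)
qed

lemma card_split: "finite E \<Longrightarrow> card {e \<in> E. P e} + card {e \<in> E. \<not> P e} = card E"
proof -
  assume "finite E"
  then have "card ({e \<in> E. P e} \<union> {e \<in> E. \<not> P e}) = card {e \<in> E. P e} + card {e \<in> E. \<not> P e}"
    by (intro card_Un_disjoint) auto
  moreover have "{e \<in> E. P e} \<union> {e \<in> E. \<not> P e} = E"
    by auto
  ultimately show ?thesis
    by simp
qed

text \<open>If exactly one of two edges has its slope between \<open>s1\<close> and \<open>s2\<close>, then their normal rays
  cross for one of the four directions \<open>v\<close>, \<open>- v\<close> with \<open>v\<close> of slope \<open>s1\<close> or \<open>s2\<close>.\<close>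

lemma crossings_ge_cut_size:
  fixes \<rho> s1 s2 :: real and a :: "'e \<Rightarrow> plane" and b :: "'f \<Rightarrow> plane"
  defines "\<sigma> \<equiv> \<lambda>u :: plane. u$2 / (u$1 + \<rho> * u$2)"
  assumes "finite E" "finite F"
    and a0: "\<And>e. e \<in> E \<Longrightarrow> (a e)$1 + \<rho> * (a e)$2 \<noteq> 0"
    and b0: "\<And>f. f \<in> F \<Longrightarrow> (b f)$1 + \<rho> * (b f)$2 \<noteq> 0"
    and "s1 < s2"
    and as: "\<And>e. e \<in> E \<Longrightarrow> \<sigma> (a e) \<noteq> s1 \<and> \<sigma> (a e) \<noteq> s2"
    and bs: "\<And>f. f \<in> F \<Longrightarrow> \<sigma> (b f) \<noteq> s1 \<and> \<sigma> (b f) \<noteq> s2"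
  defines "x \<equiv> card {e \<in> E. s1 < \<sigma> (a e) \<and> \<sigma> (a e) < s2}"
    and "y \<equiv> card {f \<in> F. s1 < \<sigma> (b f) \<and> \<sigma> (b f) < s2}"
  shows "\<exists>v. 4 * real (card (crossings E a F b v)) \<ge> cut_size (card E) (card F) x y"
proof -
  \<comment> \<open>\<open>V s\<close> is the vector of slope s whose sheared first coordinate is 1.
    Hence \<open>crs (V s) u\<close> is \<open>\<sigma> u - s\<close> up to the sheared first
    coordinate of u.\<close>
  define V where "V s = (vector [1 - \<rho> * s, s] :: plane)" for s
  define S where "S v = {(e, f) \<in> E \<times> F. crs (b f) (a e) \<noteq> 0 \<and> crs v (a e) * crs v (b f) > 0}" for v
  define in1 where "in1 u \<longleftrightarrow> s1 < \<sigma> u \<and> \<sigma> u < s2" for u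
  define X X' where "X = {e \<in> E. in1 (a e)}" and "X' = {e \<in> E. \<not> in1 (a e)}"
  define Y Y' where "Y = {f \<in> F. in1 (b f)}" and "Y' = {f \<in> F. \<not> in1 (b f)}"
  have crsV: "crs (V s) u = (u$1 + \<rho> * u$2) * (\<sigma> u - s)" if "u$1 + \<rho> * u$2 \<noteq> 0" for s u
    using that by (simp add: crs_def V_def \<sigma>_def field_simps)
  have crs\<sigma>: "crs w u = (w$1 + \<rho> * w$2) * (u$1 + \<rho> * u$2) * (\<sigma> u - \<sigma> w)"
    if "u$1 + \<rho> * u$2 \<noteq> 0" "w$1 + \<rho> * w$2 \<noteq> 0" for u w
  proof -
    have "(w$1 + \<rho> * w$2) * (u$1 + \<rho> * u$2) * (\<sigma> u - \<sigma> w)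
        = (w$1 + \<rho> * w$2) * ((u$1 + \<rho> * u$2) * \<sigma> u) - (u$1 + \<rho> * u$2) * ((w$1 + \<rho> * w$2) * \<sigma> w)"
      by (simp add: algebra_simps)
    also have "\<dots> = (w$1 + \<rho> * w$2) * u$2 - (u$1 + \<rho> * u$2) * w$2"
      using that by (simp add: \<sigma>_def)
    finally show ?thesis
      by (simp add: crs_def algebra_simps)
  qed
  have key: "(e, f) \<in> S (V s1) \<union> S (V s2)"
    if e: "e \<in> E" and f: "f \<in> F" and ne: "in1 (a e) \<noteq> in1 (b f)" for e f
  proof -
    define c where "c = ((a e)$1 + \<rho> * (a e)$2) * ((b f)$1 + \<rho> * (b f)$2)"
    have c: "c \<noteq> 0"
      using a0[OF e] b0[OF f] by (simp add: c_def)
    have "\<sigma> (a e) \<noteq> \<sigma> (b f)"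
      using ne by (auto simp: in1_def)
    then have "crs (b f) (a e) \<noteq> 0"
      using crs\<sigma>[OF a0[OF e] b0[OF f]] a0[OF e] b0[OF f] by simp
    moreover have eq: "crs (V s) (a e) * crs (V s) (b f) = c * ((\<sigma> (a e) - s) * (\<sigma> (b f) - s))" for s
      using crsV[OF a0[OF e]] crsV[OF b0[OF f]] by (simp add: c_def)
    \<comment> \<open>The product for s is negative exactly if s separates the two slopes. With one
      slope inside the interval and the other outside, exactly one end separates them; so whatever
      the sign of c, one of the two ends gives a positive value.\<close>
    have opp: "((\<sigma> (a e) - s1) * (\<sigma> (b f) - s1) > 0 \<and> (\<sigma> (a e) - s2) * (\<sigma> (b f) - s2) < 0) \<or>
        ((\<sigma> (a e) - s1) * (\<sigma> (b f) - s1) < 0 \<and> (\<sigma> (a e) - s2) * (\<sigma> (b f) - s2) > 0)"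
      using ne as[OF e] bs[OF f] \<open>s1 < s2\<close> unfolding in1_def zero_less_mult_iff mult_less_0_iff
      by force
    have "crs (V s1) (a e) * crs (V s1) (b f) > 0 \<or> crs (V s2) (a e) * crs (V s2) (b f) > 0"
      unfolding eq using c opp by (auto simp: zero_less_mult_iff mult_less_0_iff)
    ultimately show ?thesis
      using e f by (auto simp: S_def)
  qed
  have "X \<times> Y' \<union> X' \<times> Y \<subseteq> S (V s1) \<union> S (V s2)"
    using key unfolding X_def X'_def Y_def Y'_def by blast
  moreover have finS: "finite (S v)" for v
    unfolding S_def using assms(2,3) by (auto intro: finite_subset[of _ "E \<times> F"])
  ultimately have "card (X \<times> Y' \<union> X' \<times> Y) \<le> card (S (V s1)) + card (S (V s2))"
    by (meson card_Un_le card_mono finite_UnI le_trans)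
  moreover have "card (X \<times> Y' \<union> X' \<times> Y) = card X * card Y' + card X' * card Y"
  proof -
    have "finite X" "finite X'" "finite Y" "finite Y'"
      using assms(2,3) by (auto simp: X_def X'_def Y_def Y'_def)
    moreover have "(X \<times> Y') \<inter> (X' \<times> Y) = {}"
      by (auto simp: X_def X'_def)
    ultimately show ?thesis
      by (simp add: card_Un_disjoint card_cartesian_product)
  qed
  moreover have "card X = x" "card Y = y"
    by (simp_all add: X_def Y_def x_def y_def in1_def)
  moreover have "real (card X') = real (card E) - real x" "real (card Y') = real (card F) - real y"
    using card_split[OF assms(2), of "\<lambda>e. in1 (a e)"] card_split[OF assms(3), of "\<lambda>f. in1 (b f)"]
      \<open>card X = x\<close> \<open>card Y = y\<close> by (simp_all add: X_def X'_def Y_def Y'_def)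
  moreover have "real x * real (card Y') + real (card X') * real y \<le> real (card (S (V s1)) + card (S (V s2)))"
    if "x * card Y' + card X' * y \<le> card (S (V s1)) + card (S (V s2))"
    using that by (simp flip: of_nat_mult of_nat_add)
  ultimately have "cut_size (card E) (card F) x y \<le> real (card (S (V s1)) + card (S (V s2)))"
    by (simp add: cut_size_def mult.commute)
  also have "\<dots> = real (card (crossings E a F b (V s1)) + card (crossings E a F b (- V s1))
      + card (crossings E a F b (V s2)) + card (crossings E a F b (- V s2)))"
    unfolding S_def card_crossings_uminus[OF assms(2,3)] by simp
  finally have le: "cut_size (card E) (card F) x y \<le> \<dots>" .
  show ?thesis
  \<comment> \<open>The four numbers of crossings sum to at least the cut size, so one of them is at
    least a quarter of it.\<close>
  proof (rule ccontr)
    assume "\<not> ?thesis"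
    then have "4 * real (card (crossings E a F b v)) < cut_size (card E) (card F) x y" for v
      by (meson not_le)
    from this[of "V s1"] this[of "- V s1"] this[of "V s2"] this[of "- V s2"] le
    show False
      by simp
  qed
qed

text \<open>The median slope t is the first one at which the edges counted so far reach half of E or
  half of F. The hypotheses on nonparallel edges ensure that at most n - 2 and m - 2 edges have
  slope t, as the estimates for the middle part require.\<close>

lemma exists_crossings_ge:
  fixes a :: "'e \<Rightarrow> plane" and b :: "'f \<Rightarrow> plane"
  assumes fin: "finite E" "finite F"
    and nz: "\<And>e. e \<in> E \<Longrightarrow> a e \<noteq> 0" "\<And>f. f \<in> F \<Longrightarrow> b f \<noteq> 0"
    and npA: "\<And>d. d \<noteq> 0 \<Longrightarrow> 2 \<le> card {e \<in> E. crs d (a e) \<noteq> 0}"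
    and npB: "\<And>d. d \<noteq> 0 \<Longrightarrow> 2 \<le> card {f \<in> F. crs d (b f) \<noteq> 0}"
    and n3: "3 \<le> card E" and m3: "3 \<le> card F"
  shows "\<exists>v. real (card (crossings E a F b v)) \<ge> sqrt ((real (card E) - 2) * (real (card F) - 2))"
proof -
  have "finite (a ` E \<union> b ` F)" "0 \<notin> a ` E \<union> b ` F"
    using fin nz by force+
  then obtain \<rho> where \<rho>: "\<And>d. d \<in> a ` E \<union> b ` F \<Longrightarrow> d$1 + \<rho> * d$2 \<noteq> 0"
    using finite_ex_shear by blast
  define \<sigma> where "\<sigma> u = u$2 / (u$1 + \<rho> * u$2)" for u :: plane
  define \<Sigma> where "\<Sigma> = \<sigma> ` (a ` E \<union> b ` F)"
  define X where "X J = card {e \<in> E. \<sigma> (a e) \<in> J}" for J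
  define Y where "Y J = card {f \<in> F. \<sigma> (b f) \<in> J}" for J
  define T where "T = {s \<in> \<Sigma>. card E \<le> 2 * X {..s} \<or> card F \<le> 2 * Y {..s}}"
  have fin\<Sigma>: "finite \<Sigma>" "\<Sigma> \<noteq> {}"
    using fin n3 by (auto simp: \<Sigma>_def)
  have in\<Sigma>: "\<sigma> (a e) \<in> \<Sigma>" if "e \<in> E" for e
    using that by (auto simp: \<Sigma>_def)
  have in\<Sigma>': "\<sigma> (b f) \<in> \<Sigma>" if "f \<in> F" for f
    using that by (auto simp: \<Sigma>_def)
  have "X {..Max \<Sigma>} = card E"
    unfolding X_def using in\<Sigma> Max_ge[OF fin\<Sigma>(1)] by (intro arg_cong[of _ _ card]) blast
  then have "Max \<Sigma> \<in> T"
    using fin\<Sigma> by (simp add: T_def)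
  then have finT: "finite T" "T \<noteq> {}"
    using fin\<Sigma>(1) by (simp add: T_def, blast)
  define t where "t = Min T"
  have tT: "t \<in> T" and tmin: "\<And>s. s \<in> T \<Longrightarrow> t \<le> s"
    using finT by (auto simp: t_def)
  have t\<Sigma>: "t \<in> \<Sigma>"
    using tT by (auto simp: T_def)
  have below: "2 * X {..<t} < card E \<and> 2 * Y {..<t} < card F"
  proof (cases "\<Sigma> \<inter> {..<t} = {}")
    case True
    then have "{e \<in> E. \<sigma> (a e) \<in> {..<t}} = {}" "{f \<in> F. \<sigma> (b f) \<in> {..<t}} = {}"
      using in\<Sigma> in\<Sigma>' by blast+
    then have "X {..<t} = 0" "Y {..<t} = 0"
      by (simp_all only: X_def Y_def card.empty)
    then show ?thesis
      using n3 m3 by auto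
  next
    case False
    \<comment> \<open>Below t the counts change only at slopes that occur, and the largest of them
      is not in \<open>T\<close> by minimality of t.\<close>
    define s where "s = Max (\<Sigma> \<inter> {..<t})"
    have "s \<in> \<Sigma> \<inter> {..<t}"
      unfolding s_def using False fin\<Sigma> by (intro Max_in) auto
    moreover have sm: "\<sigma>' \<le> s" if "\<sigma>' \<in> \<Sigma>" "\<sigma>' < t" for \<sigma>'
      unfolding s_def using that fin\<Sigma> by (intro Max_ge) auto
    ultimately have iff: "\<sigma>' \<in> {..<t} \<longleftrightarrow> \<sigma>' \<in> {..s}" if "\<sigma>' \<in> \<Sigma>" for \<sigma>'
      using that by force
    have "{e \<in> E. \<sigma> (a e) \<in> {..<t}} = {e \<in> E. \<sigma> (a e) \<in> {..s}}"
      "{f \<in> F. \<sigma> (b f) \<in> {..<t}} = {f \<in> F. \<sigma> (b f) \<in> {..s}}"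
      using iff in\<Sigma> in\<Sigma>' by blast+
    then have "X {..<t} = X {..s}" "Y {..<t} = Y {..s}"
      by (simp_all only: X_def Y_def)
    moreover have "s \<notin> T"
      using tmin[of s] \<open>s \<in> \<Sigma> \<inter> {..<t}\<close> by auto
    ultimately show ?thesis
      using \<open>s \<in> \<Sigma> \<inter> {..<t}\<close> by (auto simp: T_def)
  qed
  \<comment> \<open>A gap around t free of other slopes, so that intervals can be cut just before
    and just after t without an end being a slope.\<close>
  have "\<exists>\<delta>>0. \<forall>s\<in>\<Sigma> - {t}. \<delta> < \<bar>s - t\<bar>"
  proof (cases "\<Sigma> - {t} = {}")
    case False
    define \<mu> where "\<mu> = Min ((\<lambda>s. \<bar>s - t\<bar>) ` (\<Sigma> - {t}))"
    have "\<mu> \<in> (\<lambda>s. \<bar>s - t\<bar>) ` (\<Sigma> - {t})"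
      unfolding \<mu>_def using False fin\<Sigma> by (intro Min_in) auto
    then have "\<mu> > 0"
      by auto
    moreover have "\<mu> \<le> \<bar>s - t\<bar>" if "s \<in> \<Sigma> - {t}" for s
      unfolding \<mu>_def using that fin\<Sigma> by (intro Min_le) auto
    ultimately show ?thesis
      by (intro exI[of _ "\<mu> / 2"]) fastforce
  qed (auto intro: exI[of _ 1])
  then obtain \<delta>' where \<delta>': "\<delta>' > 0" "\<And>s. s \<in> \<Sigma> - {t} \<Longrightarrow> \<delta>' < \<bar>s - t\<bar>"
    by blast
  \<comment> \<open>A value below 1 keeps the cuts next to t strictly inside the outer ends, which
    lie 1 beyond the extreme slopes.\<close>
  define \<delta> where "\<delta> = min \<delta>' (1/2)"
  have \<delta>: "0 < \<delta>" "\<delta> < 1" and far: "\<And>s. s \<in> \<Sigma> \<Longrightarrow> s \<noteq> t \<Longrightarrow> s < t - \<delta> \<or> t + \<delta> < s"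
    using \<delta>' by (fastforce simp: \<delta>_def min_def abs_if split: if_splits)+
  define s0 s3 where "s0 = Min \<Sigma> - 1" and "s3 = Max \<Sigma> + 1"
  have s03: "s0 < s" "s < s3" if "s \<in> \<Sigma>" for s
    using Min_le[OF fin\<Sigma>(1) that] Max_ge[OF fin\<Sigma>(1) that] unfolding s0_def s3_def by linarith+
  have "Min \<Sigma> \<le> t" "t \<le> Max \<Sigma>"
    using Min_le[OF fin\<Sigma>(1) t\<Sigma>] Max_ge[OF fin\<Sigma>(1) t\<Sigma>] .
  then have order: "s0 < t - \<delta>" "t - \<delta> < t + \<delta>" "t + \<delta> < s3"
    using \<delta> unfolding s0_def s3_def by linarith+
  have avoid: "s0 \<notin> \<Sigma>" "t - \<delta> \<notin> \<Sigma>" "t + \<delta> \<notin> \<Sigma>" "s3 \<notin> \<Sigma>"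
    using s03(1)[of s0] s03(2)[of s3] far[of "t - \<delta>"] far[of "t + \<delta>"] \<delta> by auto
  have reduce: "\<exists>v. 4 * real (card (crossings E a F b v)) \<ge> cut_size (card E) (card F) (X J) (Y J)"
    if "s1 < s2" "s1 \<notin> \<Sigma>" "s2 \<notin> \<Sigma>" and J: "\<And>s. s \<in> \<Sigma> \<Longrightarrow> s \<in> J \<longleftrightarrow> s1 < s \<and> s < s2" for s1 s2 J
  proof -
    have "X J = card {e \<in> E. s1 < \<sigma> (a e) \<and> \<sigma> (a e) < s2}"
        "Y J = card {f \<in> F. s1 < \<sigma> (b f) \<and> \<sigma> (b f) < s2}"
      unfolding X_def Y_def using J in\<Sigma> in\<Sigma>' by (auto intro!: arg_cong[of _ _ card])
    moreover have "\<sigma> (a e) \<noteq> s1 \<and> \<sigma> (a e) \<noteq> s2" if "e \<in> E" for e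
      using in\<Sigma>[OF that] \<open>s1 \<notin> \<Sigma>\<close> \<open>s2 \<notin> \<Sigma>\<close> by auto
    moreover have "\<sigma> (b f) \<noteq> s1 \<and> \<sigma> (b f) \<noteq> s2" if "f \<in> F" for f
      using in\<Sigma>'[OF that] \<open>s1 \<notin> \<Sigma>\<close> \<open>s2 \<notin> \<Sigma>\<close> by auto
    ultimately show ?thesis
      using crossings_ge_cut_size[OF fin, of a \<rho> b s1 s2] \<rho> \<open>s1 < s2\<close> unfolding \<sigma>_def by auto
  qed
  have sum3X: "card E = X {..<t} + X {t} + X {t<..}"
  proof -
    have "E = {e \<in> E. \<sigma> (a e) \<in> {..<t}} \<union> {e \<in> E. \<sigma> (a e) \<in> {t}} \<union> {e \<in> E. \<sigma> (a e) \<in> {t<..}}"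
      by auto
    then have "card E = card ({e \<in> E. \<sigma> (a e) \<in> {..<t}} \<union> {e \<in> E. \<sigma> (a e) \<in> {t}} \<union> {e \<in> E. \<sigma> (a e) \<in> {t<..}})"
      by simp
    also have "\<dots> = X {..<t} + X {t} + X {t<..}"
      unfolding X_def using fin by (subst card_Un_disjoint; auto)+
    finally show ?thesis .
  qed
  have sum3Y: "card F = Y {..<t} + Y {t} + Y {t<..}"
  proof -
    have "F = {f \<in> F. \<sigma> (b f) \<in> {..<t}} \<union> {f \<in> F. \<sigma> (b f) \<in> {t}} \<union> {f \<in> F. \<sigma> (b f) \<in> {t<..}}"
      by auto
    then have "card F = card ({f \<in> F. \<sigma> (b f) \<in> {..<t}} \<union> {f \<in> F. \<sigma> (b f) \<in> {t}} \<union> {f \<in> F. \<sigma> (b f) \<in> {t<..}})"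
      by simp
    also have "\<dots> = Y {..<t} + Y {t} + Y {t<..}"
      unfolding Y_def using fin by (subst card_Un_disjoint; auto)+
    finally show ?thesis .
  qed
  have sum2: "X {..t} = X {..<t} + X {t}" "Y {..t} = Y {..<t} + Y {t}"
  proof -
    have "{e \<in> E. \<sigma> (a e) \<in> {..t}} = {e \<in> E. \<sigma> (a e) \<in> {..<t}} \<union> {e \<in> E. \<sigma> (a e) \<in> {t}}"
      "{f \<in> F. \<sigma> (b f) \<in> {..t}} = {f \<in> F. \<sigma> (b f) \<in> {..<t}} \<union> {f \<in> F. \<sigma> (b f) \<in> {t}}"
      by auto
    then show "X {..t} = X {..<t} + X {t}" "Y {..t} = Y {..<t} + Y {t}"
      unfolding X_def Y_def using fin by (auto simp: card_Un_disjoint disjoint_iff)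
  qed
  \<comment> \<open>The direction of slope t; the edges of slope t are parallel to it.\<close>
  define d :: plane where "d = vector [1 - \<rho> * t, t]"
  have "d \<noteq> 0"
    by (cases "t = 0") (auto simp: d_def vec_eq_iff forall_2)
  have parallel: "crs d u = 0" if "u$1 + \<rho> * u$2 \<noteq> 0" "\<sigma> u = t" for u
    using that by (auto simp: d_def crs_def \<sigma>_def field_simps)
  have atomX: "X {t} + 2 \<le> card E"
  proof -
    have "card {e \<in> E. crs d (a e) \<noteq> 0} \<le> card {e \<in> E. \<sigma> (a e) \<notin> {t}}"
      using fin \<rho> parallel by (intro card_mono) auto
    then show ?thesis
      using npA[OF \<open>d \<noteq> 0\<close>] card_split[OF fin(1), of "\<lambda>e. \<sigma> (a e) \<in> {t}"] by (simp add: X_def)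
  qed
  have atomY: "Y {t} + 2 \<le> card F"
  proof -
    have "card {f \<in> F. crs d (b f) \<noteq> 0} \<le> card {f \<in> F. \<sigma> (b f) \<notin> {t}}"
      using fin \<rho> parallel by (intro card_mono) auto
    then show ?thesis
      using npB[OF \<open>d \<noteq> 0\<close>] card_split[OF fin(2), of "\<lambda>f. \<sigma> (b f) \<in> {t}"] by (simp add: Y_def)
  qed
  have "card E \<le> 2 * (X {..<t} + X {t}) \<or> card F \<le> 2 * (Y {..<t} + Y {t})"
    using tT sum2 by (simp add: T_def)
  then have "\<exists>(x, y) \<in> {(X {..<t} + X {t}, Y {..<t} + Y {t}), (X {t}, Y {t}),
        (X {..<t}, Y {..<t}), (X {t<..}, Y {t<..})}.
      cut_size (card E) (card F) (real x) (real y) \<ge> 4 * sqrt ((real (card E) - 2) * (real (card F) - 2))"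
    using sum3X sum3Y n3 m3 atomX atomY below by (intro cut_size_parts) auto
  then obtain J where J: "J \<in> {{..t}, {t}, {..<t}, {t<..}}"
      "cut_size (card E) (card F) (X J) (Y J) \<ge> 4 * sqrt ((real (card E) - 2) * (real (card F) - 2))"
    unfolding sum2[symmetric] by auto
  \<comment> \<open>Each part is cut out of the slopes by an open interval whose ends are two of
    \<open>s0\<close>, \<open>t - \<delta>\<close>, \<open>t + \<delta>\<close> and
    \<open>s3\<close>.\<close>
  have "\<exists>s1 s2. s1 < s2 \<and> s1 \<notin> \<Sigma> \<and> s2 \<notin> \<Sigma> \<and> (\<forall>s\<in>\<Sigma>. s \<in> J \<longleftrightarrow> s1 < s \<and> s < s2)"
  proof -
    consider "J = {..t}" | "J = {t}" | "J = {..<t}" | "J = {t<..}"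
      using J(1) by auto
    then show ?thesis
    proof cases
      case 1
      then show ?thesis
        using order avoid s03 far \<delta> by (intro exI[of _ s0] exI[of _ "t + \<delta>"]) fastforce
    next
      case 2
      then show ?thesis
        using order avoid s03 far \<delta> by (intro exI[of _ "t - \<delta>"] exI[of _ "t + \<delta>"]) fastforce
    next
      case 3
      then show ?thesis
        using order avoid s03 far \<delta> by (intro exI[of _ s0] exI[of _ "t - \<delta>"]) fastforce
    next
      case 4
      then show ?thesis
        using order avoid s03 far \<delta> by (intro exI[of _ "t + \<delta>"] exI[of _ s3]) fastforce
    qed
  qed
  then obtain v where "4 * real (card (crossings E a F b v)) \<ge> cut_size (card E) (card F) (X J) (Y J)"
    using reduce by meson
  then show ?thesis
    using J(2) by (intro exI[of _ v]) linarith
qed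

section \<open>Generic heights\<close>

lemma eventually_at_right_notin_finite:
  fixes S :: "real set"
  assumes "finite S"
  shows "\<forall>\<^sub>F t in at_right x. t \<notin> S"
proof -
  have "\<forall>\<^sub>F t in at x. t \<notin> S"
    using assms islimpt_finite islimpt_iff_eventually by blast
  then show ?thesis
    using eventually_at_split by blast
qed

text \<open>The powers of \<open>t\<close> are a small perturbation in general position; the linear term \<open>R * (p \<bullet> b)\<close>
  moves the subdivision of \<open>B\<close> far away from that of \<open>A\<close>.\<close>

definition perturbed :: "(plane \<Rightarrow> nat) \<Rightarrow> real \<Rightarrow> plane \<Rightarrow> real" where
  "perturbed i t a = a \<bullet> a + t ^ Suc (i a)"

lemma tendsto_perturbed: "((\<lambda>t. perturbed i t a) \<longlongrightarrow> a \<bullet> a) (at_right 0)"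
proof -
  \<comment> \<open>The exponent starts at 1, so that every perturbation vanishes in the limit, also
    for index 0.\<close>
  have "((\<lambda>t. perturbed i t a) \<longlongrightarrow> a \<bullet> a + 0 ^ Suc (i a)) (at_right 0)"
    unfolding perturbed_def by (intro tendsto_intros)
  then show ?thesis
    by simp
qed

text \<open>For heights \<open>x \<bullet> x\<close> and gradient -2 a, the value at x exceeds that
  at a by the squared distance of x and a. These finitely many positive gaps survive a small
  perturbation.\<close>

lemma eventually_low_singleton:
  assumes "finite A"
  shows "\<forall>\<^sub>F t in at_right 0. \<forall>a\<in>A. low A (perturbed i t) ((-2) *\<^sub>R a) = {a}"
proof -
  have "\<forall>\<^sub>F t in at_right 0. x = a \<or>
      ((-2) *\<^sub>R a) \<bullet> x + perturbed i t x > ((-2) *\<^sub>R a) \<bullet> a + perturbed i t a" for a x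
  proof (cases "x = a")
    case False
    have lim: "((\<lambda>t. (((-2) *\<^sub>R a) \<bullet> x + perturbed i t x) - (((-2) *\<^sub>R a) \<bullet> a + perturbed i t a)) \<longlongrightarrow>
        (((-2) *\<^sub>R a) \<bullet> x + x \<bullet> x) - (((-2) *\<^sub>R a) \<bullet> a + a \<bullet> a)) (at_right 0)"
      by (intro tendsto_intros tendsto_perturbed)
    have eq: "(((-2) *\<^sub>R a) \<bullet> x + x \<bullet> x) - (((-2) *\<^sub>R a) \<bullet> a + a \<bullet> a) = (x - a) \<bullet> (x - a)"
      by (simp add: inner_diff_left inner_diff_right inner_commute)
    have "(x - a) \<bullet> (x - a) > 0"
      using False by simp
    then have "\<forall>\<^sub>F t in at_right 0.
        (((-2) *\<^sub>R a) \<bullet> x + perturbed i t x) - (((-2) *\<^sub>R a) \<bullet> a + perturbed i t a) > 0"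
      by (rule order_tendstoD(1)[OF lim[unfolded eq]])
    then show ?thesis
      by (rule eventually_mono) simp
  qed simp
  then have "\<forall>\<^sub>F t in at_right 0. \<forall>a\<in>A. \<forall>x\<in>A. x = a \<or>
      ((-2) *\<^sub>R a) \<bullet> x + perturbed i t x > ((-2) *\<^sub>R a) \<bullet> a + perturbed i t a"
    using assms by (intro eventually_ball_finite ballI) auto
  then show ?thesis
  proof (rule eventually_mono, intro ballI)
    fix t a
    assume *: "\<forall>a\<in>A. \<forall>x\<in>A. x = a \<or>
      ((-2) *\<^sub>R a) \<bullet> x + perturbed i t x > ((-2) *\<^sub>R a) \<bullet> a + perturbed i t a" and "a \<in> A"
    show "low A (perturbed i t) ((-2) *\<^sub>R a) = {a}"
    proof (intro equalityI subsetI)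
      fix x assume x: "x \<in> low A (perturbed i t) ((-2) *\<^sub>R a)"
      then have "x \<in> A" "((-2) *\<^sub>R a) \<bullet> x + perturbed i t x \<le> ((-2) *\<^sub>R a) \<bullet> a + perturbed i t a"
        using \<open>a \<in> A\<close> unfolding minset_def by blast+
      then show "x \<in> {a}"
        using * \<open>a \<in> A\<close> by (metis not_le singletonI)
    next
      fix x assume "x \<in> {a}"
      moreover have "((-2) *\<^sub>R a) \<bullet> a + perturbed i t a \<le> ((-2) *\<^sub>R a) \<bullet> y + perturbed i t y" if "y \<in> A" for y
        using * \<open>a \<in> A\<close> that by (metis less_imp_le order_refl)
      ultimately show "x \<in> low A (perturbed i t) ((-2) *\<^sub>R a)"
        using \<open>a \<in> A\<close> by (simp add: minset_def)
    qed
  qed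
qed

text \<open>Several points of A may lie on one side of the hull. A point of that side beyond two
  consecutive ones must be lifted strictly above the line through their lifts, otherwise the two
  would not form a lower edge. Only extrapolation is needed, as no point lies between consecutive
  ones.\<close>

definition convex_on_lines :: "plane set \<Rightarrow> (plane \<Rightarrow> real) \<Rightarrow> bool" where
  "convex_on_lines A \<alpha> \<longleftrightarrow> (\<forall>a\<in>A. \<forall>a'\<in>A. \<forall>x\<in>A. \<forall>l. a \<noteq> a' \<and> (l < 0 \<or> l > 1) \<and> x = a + l *\<^sub>R (a' - a) \<longrightarrow>
     (1 - l) * \<alpha> a + l * \<alpha> a' < \<alpha> x)"

text \<open>For heights \<open>x \<bullet> x\<close> the excess over the extrapolated line is
  \<open>l (l - 1)\<close> times the squared length of a' - a, which is positive for l outside the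
  unit interval.\<close>

lemma eventually_convex_on_lines:
  assumes "finite A"
  shows "\<forall>\<^sub>F t in at_right 0. convex_on_lines A (perturbed i t)"
proof -
  have "\<forall>\<^sub>F t in at_right 0. \<forall>l. a \<noteq> a' \<and> (l < 0 \<or> l > 1) \<and> x = a + l *\<^sub>R (a' - a) \<longrightarrow>
     (1 - l) * perturbed i t a + l * perturbed i t a' < perturbed i t x" for a a' x
  proof (cases "\<exists>l. a \<noteq> a' \<and> (l < 0 \<or> l > 1) \<and> x = a + l *\<^sub>R (a' - a)")
    case True
    then obtain l where l: "a \<noteq> a'" "l < 0 \<or> l > 1" "x = a + l *\<^sub>R (a' - a)"
      by blast
    \<comment> \<open>The point x fixes l, so the condition for all l concerns one value, and only
      finitely many limits have to be considered.\<close>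
    have uniq: "l' = l" if "x = a + l' *\<^sub>R (a' - a)" for l'
      using that l by simp
    have lim: "((\<lambda>t. perturbed i t x - ((1 - l) * perturbed i t a + l * perturbed i t a')) \<longlongrightarrow>
        x \<bullet> x - ((1 - l) * (a \<bullet> a) + l * (a' \<bullet> a'))) (at_right 0)"
      by (intro tendsto_intros tendsto_perturbed)
    have eq: "x \<bullet> x - ((1 - l) * (a \<bullet> a) + l * (a' \<bullet> a')) = l * (l - 1) * ((a' - a) \<bullet> (a' - a))"
      unfolding l(3)
      by (simp add: inner_diff_left inner_diff_right inner_add_left inner_add_right inner_commute algebra_simps)
    have "l * (l - 1) > 0"
      using l(2) by (auto simp: zero_less_mult_iff)
    then have "l * (l - 1) * ((a' - a) \<bullet> (a' - a)) > 0"
      using l(1) by (intro mult_pos_pos[of "l * (l - 1)"]) auto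
    then have "\<forall>\<^sub>F t in at_right 0.
        perturbed i t x - ((1 - l) * perturbed i t a + l * perturbed i t a') > 0"
      by (rule order_tendstoD(1)[OF lim[unfolded eq]])
    then show ?thesis
      by (rule eventually_mono) (use uniq in force)
  next
    case False
    then show ?thesis
      by (intro always_eventually) blast
  qed
  then show ?thesis
    unfolding convex_on_lines_def using assms by (intro eventually_ball_finite ballI) auto
qed

section \<open>Heights that violate all affine relations\<close>

definition cayley_relation :: "plane set \<Rightarrow> plane set \<Rightarrow> (plane \<Rightarrow> real) \<Rightarrow> (plane \<Rightarrow> real) \<Rightarrow> bool" where
  "cayley_relation S S' c c' \<longleftrightarrow>
     sum c S = 0 \<and> sum c' S' = 0 \<and> (\<Sum>a\<in>S. c a *\<^sub>R a) + (\<Sum>b\<in>S'. c' b *\<^sub>R b) = 0 \<and>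
     ((\<exists>a\<in>S. c a \<noteq> 0) \<or> (\<exists>b\<in>S'. c' b \<noteq> 0))"

text \<open>One relation is fixed for every dependent pair of sets, whatever the heights. Genericity
  then means to avoid finitely many linear equations in the heights.\<close>

lemma choose_cayley_relations:
  "\<exists>C C'. \<forall>S S'. \<not> cayley_independent S S' \<longrightarrow> cayley_relation S S' (C S S') (C' S S')"
proof -
  have "\<exists>cc. \<not> cayley_independent S S' \<longrightarrow> cayley_relation S S' (fst cc) (snd cc)" for S S'
    unfolding cayley_independent_def cayley_relation_def by auto
  then have "\<exists>cc. \<forall>S S'. \<not> cayley_independent S S' \<longrightarrow>
      cayley_relation S S' (fst (cc S S')) (snd (cc S S'))"
    by (intro choice allI)
  then obtain cc where "\<forall>S S'. \<not> cayley_independent S S' \<longrightarrow>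
      cayley_relation S S' (fst (cc S S')) (snd (cc S S'))"
    by blast
  then show ?thesis
    by (intro exI[of _ "\<lambda>S S'. fst (cc S S')"] exI[of _ "\<lambda>S S'. snd (cc S S')"])
qed

text \<open>On the minimizers the height is a constant minus \<open>w \<bullet> x\<close>. A
  relation annihilates constants on each side and the linear part in total, so the heights satisfy
  it too: a dependent pair of minimizer sets forces an equation between heights.\<close>

lemma cayley_relation_low:
  assumes rel: "cayley_relation (low A \<alpha> w) (low B \<beta> w) c c'"
  shows "(\<Sum>a\<in>low A \<alpha> w. c a * \<alpha> a) + (\<Sum>b\<in>low B \<beta> w. c' b * \<beta> b) = 0"
proof -
  have *: "(\<Sum>x\<in>low X h w. d x * h x) = - (w \<bullet> (\<Sum>x\<in>low X h w. d x *\<^sub>R x))"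
    if "sum d (low X h w) = 0" for X h d
  proof (cases "low X h w = {}")
    case False
    then obtain y where y: "y \<in> low X h w"
      by blast
    have "(\<Sum>x\<in>low X h w. d x * h x) = (\<Sum>x\<in>low X h w. d x * (w \<bullet> y + h y) - w \<bullet> (d x *\<^sub>R x))"
    proof (rule sum.cong)
      fix x assume "x \<in> low X h w"
      then have "w \<bullet> x + h x = w \<bullet> y + h y"
        using minset_value[OF y] by blast
      then have "h x = w \<bullet> y + h y - w \<bullet> x"
        by simp
      then show "d x * h x = d x * (w \<bullet> y + h y) - w \<bullet> (d x *\<^sub>R x)"
        by (simp only: inner_scaleR_right right_diff_distrib)
    qed simp
    also have "\<dots> = sum d (low X h w) * (w \<bullet> y + h y) - w \<bullet> (\<Sum>x\<in>low X h w. d x *\<^sub>R x)"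
      by (simp add: sum_subtractf sum_distrib_right inner_sum_right)
    finally show ?thesis
      using that by simp
  qed simp
  have "(\<Sum>a\<in>low A \<alpha> w. c a * \<alpha> a) + (\<Sum>b\<in>low B \<beta> w. c' b * \<beta> b)
      = - (w \<bullet> ((\<Sum>a\<in>low A \<alpha> w. c a *\<^sub>R a) + (\<Sum>b\<in>low B \<beta> w. c' b *\<^sub>R b)))"
    using *[of c A \<alpha>] *[of c' B \<beta>] rel unfolding cayley_relation_def inner_add_right by linarith
  also have "\<dots> = 0"
    using rel by (simp only: cayley_relation_def inner_zero_right minus_zero)
  finally show ?thesis .
qed

text \<open>The expression is a polynomial in t. All exponents are distinct and positive, so each
  coefficient of the relation appears alone as a coefficient of the polynomial, which therefore is
  not zero and has finitely many roots.\<close>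

lemma eventually_perturbed_relation_nonzero:
  assumes "finite S" "finite S'" and rel: "cayley_relation S S' c c'"
    and inj: "inj_on i S" "inj_on j S'" "i ` S \<inter> j ` S' = {}"
  shows "\<forall>\<^sub>F t in at_right 0. (\<Sum>a\<in>S. c a * perturbed i t a) + (\<Sum>b\<in>S'. c' b * perturbed j t b) \<noteq> 0"
proof -
  define q :: "real poly" where
    "q = [:(\<Sum>a\<in>S. c a * (a \<bullet> a)) + (\<Sum>b\<in>S'. c' b * (b \<bullet> b)):]
       + (\<Sum>a\<in>S. monom (c a) (Suc (i a))) + (\<Sum>b\<in>S'. monom (c' b) (Suc (j b)))"
  have eval: "poly q t = (\<Sum>a\<in>S. c a * perturbed i t a) + (\<Sum>b\<in>S'. c' b * perturbed j t b)" for t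
    by (simp add: q_def poly_sum poly_monom perturbed_def distrib_left sum.distrib)
  have "coeff q (Suc (i a)) = c a" if "a \<in> S" for a
  proof -
    have "(\<Sum>x\<in>S. coeff (monom (c x) (Suc (i x))) (Suc (i a))) = (\<Sum>x\<in>S. if x = a then c x else 0)"
      using inj(1) that by (intro sum.cong) (auto simp: coeff_monom inj_on_def)
    moreover have "(\<Sum>x\<in>S'. coeff (monom (c' x) (Suc (j x))) (Suc (i a))) = 0"
      using inj(3) that by (intro sum.neutral) (auto simp: coeff_monom disjoint_iff image_iff)
    ultimately show ?thesis
      using assms(1) that by (simp add: q_def coeff_sum del: coeff_monom)
  qed
  moreover have "coeff q (Suc (j b)) = c' b" if "b \<in> S'" for b
  proof -
    have "(\<Sum>x\<in>S'. coeff (monom (c' x) (Suc (j x))) (Suc (j b))) = (\<Sum>x\<in>S'. if x = b then c' x else 0)"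
      using inj(2) that by (intro sum.cong) (auto simp: coeff_monom inj_on_def)
    moreover have "(\<Sum>x\<in>S. coeff (monom (c x) (Suc (i x))) (Suc (j b))) = 0"
      using inj(3) that by (intro sum.neutral) (auto simp: coeff_monom disjoint_iff image_iff)
    ultimately show ?thesis
      using assms(2) that by (simp add: q_def coeff_sum del: coeff_monom)
  qed
  ultimately have "q \<noteq> 0"
    using rel unfolding cayley_relation_def by (metis coeff_0)
  then have "finite {t. poly q t = 0}"
    by (rule poly_roots_finite)
  then have "\<forall>\<^sub>F t in at_right 0. t \<notin> {t. poly q t = 0}"
    by (rule eventually_at_right_notin_finite)
  then show ?thesis
    by (simp add: eval)
qed

text \<open>The heights must be fixed before p and R are known. It suffices that they violate the
  relations for R = 0: for every p, the term added for R makes each expression an affine function of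
  R with nonzero constant term, and such a function has no large roots.\<close>

lemma exists_generic_heights:
  fixes A B :: "plane set"
  assumes fin: "finite A" "finite B"
  obtains \<alpha> \<beta> where "convex_on_lines A \<alpha>" "convex_on_lines B \<beta>"
    "\<forall>a\<in>A. \<exists>w. low A \<alpha> w = {a}" "\<forall>b\<in>B. \<exists>w. low B \<beta> w = {b}"
    "\<forall>p. \<forall>\<^sub>F R in at_top. \<forall>w. cayley_independent (low A \<alpha> w) (low B (\<lambda>b. \<beta> b + R * (p \<bullet> b)) w)"
proof -
  obtain C C' where C: "\<And>S S'. \<not> cayley_independent S S' \<Longrightarrow> cayley_relation S S' (C S S') (C' S S')"
    using choose_cayley_relations by (elim exE) blast
  obtain i0 j0 :: "plane \<Rightarrow> nat" where inj0: "inj_on i0 A" "inj_on j0 B"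
    using finite_imp_inj_to_nat_seg fin by metis
  \<comment> \<open>Even exponents for A and odd ones for B, so that no power of t is used
    twice.\<close>
  define i j where "i a = 2 * i0 a" and "j b = 2 * j0 b + 1" for a b
  have inj: "inj_on i S" "inj_on j S'" "i ` S \<inter> j ` S' = {}" if "S \<subseteq> A" "S' \<subseteq> B" for S S'
  proof -
    have "inj_on i A" "inj_on j B"
      using inj0 by (simp_all add: i_def j_def inj_on_def)
    then show "inj_on i S" "inj_on j S'"
      using that inj_on_subset by blast+
    have "i a \<noteq> j b" for a b
      unfolding i_def j_def by presburger
    then show "i ` S \<inter> j ` S' = {}"
      by blast
  qed
  define D where "D = {(S, S'). S \<subseteq> A \<and> S' \<subseteq> B \<and> \<not> cayley_independent S S'}"
  have "D \<subseteq> Pow A \<times> Pow B"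
    by (auto simp: D_def)
  then have finD: "finite D"
    using fin by (meson finite_Pow_iff finite_SigmaI finite_subset)
  have "\<forall>\<^sub>F t in at_right 0. (\<Sum>a\<in>fst SS. C (fst SS) (snd SS) a * perturbed i t a)
      + (\<Sum>b\<in>snd SS. C' (fst SS) (snd SS) b * perturbed j t b) \<noteq> 0" if "SS \<in> D" for SS
  proof -
    have "fst SS \<subseteq> A" "snd SS \<subseteq> B" "\<not> cayley_independent (fst SS) (snd SS)"
      using that by (auto simp: D_def)
    then show ?thesis
      using fin finite_subset inj C by (intro eventually_perturbed_relation_nonzero) auto
  qed
  moreover define N where "N t \<longleftrightarrow> (\<forall>SS\<in>D. (\<Sum>a\<in>fst SS. C (fst SS) (snd SS) a * perturbed i t a)
      + (\<Sum>b\<in>snd SS. C' (fst SS) (snd SS) b * perturbed j t b) \<noteq> 0)" for t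
  ultimately have "\<forall>\<^sub>F t in at_right 0. N t"
    using finD by (simp add: eventually_ball_finite)
  then have "\<forall>\<^sub>F t in at_right 0. N t \<and> convex_on_lines A (perturbed i t) \<and> convex_on_lines B (perturbed j t) \<and>
      (\<forall>a\<in>A. low A (perturbed i t) ((-2) *\<^sub>R a) = {a}) \<and>
      (\<forall>b\<in>B. low B (perturbed j t) ((-2) *\<^sub>R b) = {b})"
    using fin by (intro eventually_conj eventually_convex_on_lines eventually_low_singleton)
  from eventually_happens'[OF trivial_limit_at_right_real this]
  obtain t where t0: "N t \<and> convex_on_lines A (perturbed i t) \<and> convex_on_lines B (perturbed j t) \<and>
      (\<forall>a\<in>A. low A (perturbed i t) ((-2) *\<^sub>R a) = {a}) \<and>
      (\<forall>b\<in>B. low B (perturbed j t) ((-2) *\<^sub>R b) = {b})"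
    by (rule exE)
  then have t: "\<And>SS. SS \<in> D \<Longrightarrow> (\<Sum>a\<in>fst SS. C (fst SS) (snd SS) a * perturbed i t a)
      + (\<Sum>b\<in>snd SS. C' (fst SS) (snd SS) b * perturbed j t b) \<noteq> 0"
      "convex_on_lines A (perturbed i t)" "convex_on_lines B (perturbed j t)"
      "\<And>a. a \<in> A \<Longrightarrow> low A (perturbed i t) ((-2) *\<^sub>R a) = {a}"
      "\<And>b. b \<in> B \<Longrightarrow> low B (perturbed j t) ((-2) *\<^sub>R b) = {b}"
    unfolding N_def by simp_all
  define \<alpha> \<beta> where "\<alpha> = perturbed i t" and "\<beta> = perturbed j t"
  show ?thesis
  proof (rule that[of \<alpha> \<beta>])
    show "convex_on_lines A \<alpha>" "convex_on_lines B \<beta>"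
      using t by (simp_all add: \<alpha>_def \<beta>_def)
    show "\<forall>a\<in>A. \<exists>w. low A \<alpha> w = {a}"
      using t(4) unfolding \<alpha>_def by blast
    show "\<forall>b\<in>B. \<exists>w. low B \<beta> w = {b}"
      using t(5) unfolding \<beta>_def by blast
    show "\<forall>p. \<forall>\<^sub>F R in at_top. \<forall>w. cayley_independent (low A \<alpha> w) (low B (\<lambda>b. \<beta> b + R * (p \<bullet> b)) w)"
    proof
      fix p
      define h where "h SS R = (\<Sum>a\<in>fst SS. C (fst SS) (snd SS) a * \<alpha> a)
        + (\<Sum>b\<in>snd SS. C' (fst SS) (snd SS) b * (\<beta> b + R * (p \<bullet> b)))" for SS and R :: real
      have "\<forall>\<^sub>F R in at_top. h SS R \<noteq> 0" if "SS \<in> D" for SS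
      proof -
        define k where "k = (\<Sum>b\<in>snd SS. C' (fst SS) (snd SS) b * (p \<bullet> b))"
        have eq: "h SS R = h SS 0 + R * k" for R
          by (simp add: h_def k_def distrib_left sum.distrib sum_distrib_left mult_ac)
        have "h SS 0 \<noteq> 0"
          using t(1)[OF that] by (simp add: h_def \<alpha>_def \<beta>_def)
        \<comment> \<open>For nonzero k this bound is the only root; for k = 0 it is 0 and the
          expression does not depend on R.\<close>
        have "\<forall>\<^sub>F R in at_top. R > - h SS 0 / k"
          by (rule eventually_gt_at_top)
        then show ?thesis
        proof (elim eventually_mono)
          fix R assume R: "R > - h SS 0 / k"
          show "h SS R \<noteq> 0"
          proof (cases "k = 0")
            case True
            then show ?thesis
              using \<open>h SS 0 \<noteq> 0\<close> eq[of R] by simp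
          next
            case False
            show ?thesis
            proof
              assume "h SS R = 0"
              then have "R * k = - h SS 0"
                using eq[of R] by linarith
              then show False
                using R False by (simp add: nonzero_eq_divide_eq[symmetric])
            qed
          qed
        qed
      qed
      then have "\<forall>\<^sub>F R in at_top. \<forall>SS\<in>D. h SS R \<noteq> 0"
        using finD by (simp add: eventually_ball_finite)
      then show "\<forall>\<^sub>F R in at_top. \<forall>w. cayley_independent (low A \<alpha> w) (low B (\<lambda>b. \<beta> b + R * (p \<bullet> b)) w)"
      proof (rule eventually_mono, intro allI)
        fix R w assume h: "\<forall>SS\<in>D. h SS R \<noteq> 0"
        define S S' where "S = low A \<alpha> w" and "S' = low B (\<lambda>b. \<beta> b + R * (p \<bullet> b)) w"
        have "S \<subseteq> A" "S' \<subseteq> B"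
          by (simp_all add: S_def S'_def minset_subset)
        show "cayley_independent (low A \<alpha> w) (low B (\<lambda>b. \<beta> b + R * (p \<bullet> b)) w)"
        proof (rule ccontr)
          assume dep: "\<not> cayley_independent (low A \<alpha> w) (low B (\<lambda>b. \<beta> b + R * (p \<bullet> b)) w)"
          then have "(S, S') \<in> D"
            using \<open>S \<subseteq> A\<close> \<open>S' \<subseteq> B\<close> by (simp add: D_def S_def S'_def)
          moreover have "h (S, S') R = 0"
            using cayley_relation_low[OF C[OF dep]] by (simp add: h_def S_def S'_def)
          ultimately show False
            using h by blast
        qed
      qed
    qed
  qed
qed

section \<open>Boundary edges\<close>

lemma crs_eq_0_scaleR:
  assumes "crs d y = 0" "d \<noteq> 0"
  shows "y = ((d \<bullet> y) / (d \<bullet> d)) *\<^sub>R d"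
proof -
  have dd: "d \<bullet> d = d$1 * d$1 + d$2 * d$2" and dy: "d \<bullet> y = d$1 * y$1 + d$2 * y$2"
    by (simp_all add: inner_vec_def sum_2)
  have "d \<bullet> d \<noteq> 0"
    using assms by simp
  moreover have "y$1 * (d \<bullet> d) = (d \<bullet> y) * d$1" "y$2 * (d \<bullet> d) = (d \<bullet> y) * d$2"
    using assms(1) unfolding dd dy crs_def by algebra+
  ultimately have "y$1 = (d \<bullet> y) / (d \<bullet> d) * d$1" "y$2 = (d \<bullet> y) / (d \<bullet> d) * d$2"
    by (simp_all add: nonzero_eq_divide_eq)
  then show ?thesis
    by (simp add: vec_eq_iff forall_2)
qed

lemma collinear_crs:
  assumes "d \<noteq> 0" "\<And>x. x \<in> A \<Longrightarrow> crs d (x - a) = 0"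
  shows "collinear A"
  unfolding collinear_def
proof (intro exI[of _ d] ballI)
  fix x y assume "x \<in> A" "y \<in> A"
  then have "x - y = ((d \<bullet> (x - a)) / (d \<bullet> d)) *\<^sub>R d - ((d \<bullet> (y - a)) / (d \<bullet> d)) *\<^sub>R d"
    using crs_eq_0_scaleR[OF assms(2,1), of x] crs_eq_0_scaleR[OF assms(2,1), of y]
    by (metis diff_diff_eq2 diff_add_cancel)
  then show "\<exists>k. x - y = k *\<^sub>R d"
    by (metis scaleR_diff_left)
qed

lemma frontier_supporting:
  fixes A :: "plane set"
  assumes "\<not> collinear A" "A \<subseteq> frontier (convex hull A)" "a \<in> A"
  obtains c where "c \<noteq> 0" "\<And>x. x \<in> A \<Longrightarrow> 0 \<le> c \<bullet> (x - a)"
proof -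
  have "rel_interior (convex hull A) = interior (convex hull A)"
    using interior_convex_hull_noncollinear[OF assms(1)] by (rule rel_interior_nonempty_interior)
  then have "a \<notin> rel_interior (convex hull A)"
    using assms by (auto simp: frontier_def)
  moreover have "a \<in> convex hull A"
    using assms by (simp add: hull_inc)
  ultimately obtain c where c: "c \<noteq> 0" "\<And>y. y \<in> convex hull A \<Longrightarrow> c \<bullet> a \<le> c \<bullet> y"
    using supporting_hyperplane_rel_boundary[OF convex_convex_hull] by metis
  show ?thesis
    using c hull_inc[of _ A convex] by (intro that[of c]) (auto simp: inner_diff_right)
qed

text \<open>The edges are oriented counterclockwise, with A weakly to the left, and join consecutive
  points: a side of the hull that carries further points of A counts as several edges. In this way
  every point of A can start an edge of its own.\<close>

definition boundary_edges :: "plane set \<Rightarrow> (plane \<times> plane) set" where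
  "boundary_edges A = {(a, a'). a \<in> A \<and> a' \<in> A \<and> a \<noteq> a' \<and>
     (\<forall>x\<in>A. crs (a' - a) (x - a) \<ge> 0 \<and> x \<notin> open_segment a a')}"

text \<open>Look along a supporting line at a, with A on its left. The successor of a is the nearest
  point ahead on that line, or, if there is none, the nearest point in the direction that turns
  least from it.\<close>

lemma boundary_edge_from:
  assumes "finite A" and nc: "\<not> collinear A" and fr: "A \<subseteq> frontier (convex hull A)" and a: "a \<in> A"
  shows "\<exists>a'. (a, a') \<in> boundary_edges A"
proof -
  obtain c where c: "c \<noteq> 0" "\<And>x. x \<in> A \<Longrightarrow> 0 \<le> c \<bullet> (x - a)"
    using frontier_supporting[OF nc fr a] by metis
  \<comment> \<open>Up to scaling, \<open>\<eta>\<close> is the height of x above the supporting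
    line and \<open>\<xi>\<close> its coordinate along that line, both measured from a.\<close>
  define \<eta> where "\<eta> x = c$1 * (x - a)$1 + c$2 * (x - a)$2" for x
  define \<xi> where "\<xi> x = c$2 * (x - a)$1 - c$1 * (x - a)$2" for x
  have \<eta>0: "\<eta> x \<ge> 0" if "x \<in> A" for x
    using c(2)[OF that] by (simp add: \<eta>_def inner_vec_def sum_2)
  have cc: "c$1 * c$1 + c$2 * c$2 > 0"
    using c(1) inner_gt_zero_iff[of c] by (simp add: inner_vec_def sum_2)
  have id: "(c$1 * c$1 + c$2 * c$2) * crs (x - a) (y - a) = \<xi> x * \<eta> y - \<eta> x * \<xi> y" for x y
    unfolding crs_def \<eta>_def \<xi>_def by algebra
  have crs_ge: "crs (x - a) (y - a) \<ge> 0" if "\<xi> x * \<eta> y - \<eta> x * \<xi> y \<ge> 0" for x y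
    using that cc unfolding id[symmetric] by (simp add: zero_le_mult_iff)
  have seg: "\<exists>l. 0 < l \<and> l < 1 \<and> \<eta> x = l * \<eta> y \<and> \<xi> x = l * \<xi> y" if "x \<in> open_segment a y" for x y
  proof -
    obtain l where l: "0 < l" "l < 1" "x = (1 - l) *\<^sub>R a + l *\<^sub>R y"
      using \<open>x \<in> open_segment a y\<close> unfolding in_segment by blast
    then have "x - a = l *\<^sub>R (y - a)"
      by (simp add: algebra_simps)
    then have comp: "(x - a)$k = l * (y - a)$k" for k
      by (simp only: vector_scaleR_component real_scaleR_def)
    have "\<eta> x = l * \<eta> y" "\<xi> x = l * \<xi> y"
      unfolding \<eta>_def \<xi>_def comp by (simp_all only: distrib_left right_diff_distrib mult.left_commute)
    then show ?thesis
      using l by blast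
  qed
  have "\<xi> a = 0" "\<eta> a = 0"
    by (simp_all add: \<xi>_def \<eta>_def)
  define P where "P = {x \<in> A. \<eta> x = 0 \<and> \<xi> x > 0}"
  show ?thesis
  proof (cases "P = {}")
    case False
    have "finite P"
      using assms(1) by (simp add: P_def)
    then obtain a' where a': "a' \<in> P" "\<And>x. x \<in> P \<Longrightarrow> \<xi> a' \<le> \<xi> x"
      using False finite_ex_minimum[of P \<xi>] by blast
    have "a' \<in> A" "a \<noteq> a'"
      using a' \<open>\<xi> a = 0\<close> by (auto simp: P_def)
    moreover have "crs (a' - a) (x - a) \<ge> 0" if "x \<in> A" for x
      using a'(1) \<eta>0[OF that] by (intro crs_ge) (simp add: P_def)
    moreover have "x \<notin> open_segment a a'" if "x \<in> A" for x
    proof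
      assume "x \<in> open_segment a a'"
      then obtain l where l: "0 < l" "l < 1" "\<eta> x = l * \<eta> a'" "\<xi> x = l * \<xi> a'"
        using seg by blast
      then have "x \<in> P"
        using a'(1) that by (simp add: P_def)
      moreover have "\<xi> x < \<xi> a'"
        using l a'(1) by (simp add: P_def)
      ultimately show False
        using a'(2) by force
    qed
    ultimately show ?thesis
      using a unfolding boundary_edges_def by blast
  next
    case True
    then have neg: "\<xi> x \<le> 0" if "x \<in> A" "\<eta> x = 0" for x
      using that by (fastforce simp: P_def)
    define Q where "Q = {x \<in> A. \<eta> x > 0}"
    have "Q \<noteq> {}"
    proof
      assume "Q = {}"
      then have "\<eta> x = 0" if "x \<in> A" for x
        using \<eta>0[OF that] that by (force simp: Q_def)
      moreover define d :: plane where "d = vector [c$2, - c$1]"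
      have "d \<noteq> 0"
        using c(1) by (auto simp: d_def vec_eq_iff forall_2)
      moreover have "crs d (x - a) = \<eta> x" for x
        by (simp add: crs_def d_def \<eta>_def)
      ultimately have "collinear A"
        by (intro collinear_crs[of d _ a]) auto
      then show False
        using nc by blast
    qed
    have finQ: "finite Q"
      using assms(1) by (simp add: Q_def)
    \<comment> \<open>The largest ratio of \<open>\<xi>\<close> to \<open>\<eta>\<close> is the
      smallest angle with the supporting line; among the points that attain it, the least
      \<open>\<eta>\<close> belongs to the nearest one.\<close>
    obtain a1 where a1: "a1 \<in> Q" "\<And>x. x \<in> Q \<Longrightarrow> - (\<xi> a1 / \<eta> a1) \<le> - (\<xi> x / \<eta> x)"
      using finite_ex_minimum[OF finQ \<open>Q \<noteq> {}\<close>, of "\<lambda>x. - (\<xi> x / \<eta> x)"] by blast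
    define Q' where "Q' = {x \<in> Q. \<xi> x / \<eta> x = \<xi> a1 / \<eta> a1}"
    have Q': "finite Q'" "Q' \<noteq> {}"
      using finQ a1(1) by (auto simp: Q'_def)
    obtain a' where a': "a' \<in> Q'" "\<And>x. x \<in> Q' \<Longrightarrow> \<eta> a' \<le> \<eta> x"
      using finite_ex_minimum[OF Q', of \<eta>] by blast
    have pos: "a' \<in> A" "\<eta> a' > 0" and ratio: "\<xi> a' / \<eta> a' = \<xi> a1 / \<eta> a1"
      using a'(1) by (auto simp: Q'_def Q_def)
    then have "a \<noteq> a'"
      using \<open>\<eta> a = 0\<close> by auto
    moreover have "crs (a' - a) (x - a) \<ge> 0" if x: "x \<in> A" for x
    proof (rule crs_ge, cases "\<eta> x = 0")
      case True
      then have "\<eta> a' * \<xi> x \<le> 0"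
        using neg[OF x] pos by (simp add: mult_nonneg_nonpos)
      then show "\<xi> a' * \<eta> x - \<eta> a' * \<xi> x \<ge> 0"
        using True by simp
    next
      case False
      then have \<eta>x: "\<eta> x > 0"
        using \<eta>0[OF x] by simp
      then have "\<xi> x / \<eta> x \<le> \<xi> a' / \<eta> a'"
        using a1(2)[of x] x ratio by (simp add: Q_def)
      then show "\<xi> a' * \<eta> x - \<eta> a' * \<xi> x \<ge> 0"
        using \<eta>x pos(2) by (simp add: field_simps)
    qed
    moreover have "x \<notin> open_segment a a'" if "x \<in> A" for x
    proof
      assume "x \<in> open_segment a a'"
      then obtain l where l: "0 < l" "l < 1" "\<eta> x = l * \<eta> a'" "\<xi> x = l * \<xi> a'"
        using seg by blast
      then have "x \<in> Q'"
        using pos ratio that by (simp add: Q'_def Q_def)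
      moreover have "\<eta> x < \<eta> a'"
        using l pos by simp
      ultimately show False
        using a'(2) by force
    qed
    ultimately show ?thesis
      using a pos(1) unfolding boundary_edges_def by blast
  qed
qed

lemma finite_boundary_edges:
  assumes "finite A"
  shows "finite (boundary_edges A)"
proof -
  have "boundary_edges A \<subseteq> A \<times> A"
    by (auto simp: boundary_edges_def)
  then show ?thesis
    using assms finite_subset by blast
qed

lemma card_boundary_edges_ge:
  assumes "finite A" "\<not> collinear A" "A \<subseteq> frontier (convex hull A)"
  shows "card A \<le> card (boundary_edges A)"
proof -
  have "A \<subseteq> fst ` boundary_edges A"
    using boundary_edge_from[OF assms] by force
  then have "card A \<le> card (fst ` boundary_edges A)"
    using finite_boundary_edges[OF assms(1)] by (simp add: card_mono)
  also have "\<dots> \<le> card (boundary_edges A)"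
    by (rule card_image_le[OF finite_boundary_edges[OF assms(1)]])
  finally show ?thesis .
qed

text \<open>Start at a point minimizing \<open>crs d\<close>, and among those at one that is
  farthest along d. The edge from there cannot descend. Were it parallel to d, it would point
  against d and have A on its left, while minimality puts A on the other side; A would be
  collinear.\<close>

lemma boundary_edge_crs_pos:
  assumes "finite A" and nc: "\<not> collinear A" and fr: "A \<subseteq> frontier (convex hull A)" and d: "d \<noteq> 0"
  shows "\<exists>(a, a') \<in> boundary_edges A. crs d (a' - a) > 0"
proof -
  have "A \<noteq> {}"
    using nc by auto
  have crs_diff: "crs d (x - y) = crs d x - crs d y" for x y
    by (simp add: crs_def algebra_simps)
  obtain a1 where a1: "a1 \<in> A" "\<And>x. x \<in> A \<Longrightarrow> crs d a1 \<le> crs d x"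
    using finite_ex_minimum[OF assms(1) \<open>A \<noteq> {}\<close>, of "crs d"] by blast
  define A' where "A' = {x \<in> A. crs d x = crs d a1}"
  have A': "finite A'" "A' \<noteq> {}"
    using assms(1) a1 by (auto simp: A'_def)
  obtain a where a: "a \<in> A'" "\<And>x. x \<in> A' \<Longrightarrow> - (d \<bullet> a) \<le> - (d \<bullet> x)"
    using finite_ex_minimum[OF A', of "\<lambda>x. - (d \<bullet> x)"] by blast
  have aA: "a \<in> A" and amin: "\<And>x. x \<in> A \<Longrightarrow> crs d (x - a) \<ge> 0"
    using a(1) a1(2) by (auto simp: A'_def crs_diff)
  obtain a' where a': "(a, a') \<in> boundary_edges A"
    using boundary_edge_from[OF assms(1-3) aA] by blast
  then have "a' \<in> A" "a \<noteq> a'" and left: "\<And>x. x \<in> A \<Longrightarrow> crs (a' - a) (x - a) \<ge> 0"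
    by (auto simp: boundary_edges_def)
  have "crs d (a' - a) \<noteq> 0"
  proof
    assume 0: "crs d (a' - a) = 0"
    define k where "k = (d \<bullet> (a' - a)) / (d \<bullet> d)"
    have k: "a' - a = k *\<^sub>R d"
      unfolding k_def by (rule crs_eq_0_scaleR[OF 0 d])
    have "a' \<in> A'"
      using 0 \<open>a' \<in> A\<close> a(1) by (simp add: A'_def crs_diff)
    then have "d \<bullet> (a' - a) \<le> 0"
      using a(2)[of a'] by (simp add: inner_diff_right)
    then have "k \<le> 0"
      by (simp add: k_def divide_nonpos_nonneg)
    moreover have "k \<noteq> 0"
      using k \<open>a \<noteq> a'\<close> by auto
    ultimately have "k < 0"
      by simp
    have "crs d (x - a) = 0" if "x \<in> A" for x
    proof -
      have "crs (a' - a) (x - a) = k * crs d (x - a)"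
        unfolding k by (simp add: crs_def algebra_simps)
      then have "k * crs d (x - a) \<ge> 0"
        using left[OF that] by simp
      then show ?thesis
        using \<open>k < 0\<close> amin[OF that] by (simp add: zero_le_mult_iff)
    qed
    then show False
      using collinear_crs[OF d] nc by blast
  qed
  then have "crs d (a' - a) > 0"
    using amin[OF \<open>a' \<in> A\<close>] by simp
  then show ?thesis
    using a' by blast
qed

text \<open>A closed boundary that rises across d must also descend: d and its negative yield two
  different edges.\<close>

lemma two_le_card_nonparallel_edges:
  assumes "finite A" "\<not> collinear A" "A \<subseteq> frontier (convex hull A)" "d \<noteq> 0"
  shows "2 \<le> card {e \<in> boundary_edges A. crs d (snd e - fst e) \<noteq> 0}"
proof -
  obtain e where e: "e \<in> boundary_edges A" "crs d (snd e - fst e) > 0"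
    using boundary_edge_crs_pos[OF assms] by auto
  obtain e' where e': "e' \<in> boundary_edges A" "crs (- d) (snd e' - fst e') > 0"
    using boundary_edge_crs_pos[OF assms(1-3), of "- d"] assms(4) by auto
  have "crs (- d) x = - crs d x" for x
    by (simp add: crs_def)
  then have "crs d (snd e' - fst e') < 0"
    using e'(2) by simp
  then have "e \<noteq> e'" "{e, e'} \<subseteq> {e \<in> boundary_edges A. crs d (snd e - fst e) \<noteq> 0}"
    using e e'(1) by auto
  moreover have "finite {e \<in> boundary_edges A. crs d (snd e - fst e) \<noteq> 0}"
    using finite_boundary_edges[OF assms(1)] by simp
  ultimately have "card {e, e'} \<le> card {e \<in> boundary_edges A. crs d (snd e - fst e) \<noteq> 0}"
    by (intro card_mono)
  then show ?thesis
    using \<open>e \<noteq> e'\<close> by simp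
qed

text \<open>With both orientations A would lie on both sides of the line. Consequently an edge can
  be recovered from its unoriented segment.\<close>

lemma boundary_edges_asym:
  assumes "\<not> collinear A" "(a, a') \<in> boundary_edges A"
  shows "(a', a) \<notin> boundary_edges A"
proof
  assume "(a', a) \<in> boundary_edges A"
  then have "crs (a - a') (x - a') \<ge> 0" if "x \<in> A" for x
    using that by (auto simp: boundary_edges_def)
  moreover have "crs (a' - a) (x - a) \<ge> 0" if "x \<in> A" for x
    using that assms(2) by (auto simp: boundary_edges_def)
  moreover have "crs (a - a') (x - a') = - crs (a' - a) (x - a)" for x
    by (simp add: crs_def algebra_simps)
  ultimately have "crs (a' - a) (x - a) = 0" if "x \<in> A" for x
    using that by (metis neg_0_le_iff_le order_antisym)
  moreover have "a' - a \<noteq> 0"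
    using assms(2) by (auto simp: boundary_edges_def)
  ultimately show False
    using collinear_crs assms(1) by blast
qed

section \<open>Boundary edges as lower edges, and the crossing of their rays\<close>

definition rot :: "plane \<Rightarrow> plane" where
  "rot u = vector [- u$2, u$1]"

lemma inner_rot: "rot u \<bullet> y = crs u y"
  by (simp add: rot_def inner_vec_def sum_2 crs_def)

text \<open>\<open>rot (a' - a)\<close> is the inner normal of the edge. A large multiple of it in
  the gradient lifts all points off the line of the edge above a and a', whose values stay equal;
  further points on that line are above them by convexity.\<close>

lemma eventually_low_boundary_edge:
  assumes "finite A" and cvx: "convex_on_lines A \<alpha>" and e: "(a, a') \<in> boundary_edges A"
    and eq: "w \<bullet> a + \<alpha> a = w \<bullet> a' + \<alpha> a'" and "s > 0"
  shows "\<forall>\<^sub>F R in at_top. low A \<alpha> ((R * s) *\<^sub>R rot (a' - a) + w) = {a, a'}"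
proof -
  define f where "f R x = ((R * s) *\<^sub>R rot (a' - a) + w) \<bullet> x + \<alpha> x" for R x
  have aA: "a \<in> A" "a' \<in> A" "a \<noteq> a'"
    and left: "\<And>x. x \<in> A \<Longrightarrow> crs (a' - a) (x - a) \<ge> 0"
    and seg: "\<And>x. x \<in> A \<Longrightarrow> x \<notin> open_segment a a'"
    using e by (auto simp: boundary_edges_def)
  have diff: "f R x - f R a = R * (s * crs (a' - a) (x - a)) + (w \<bullet> (x - a) + \<alpha> x - \<alpha> a)" for R x
    by (simp add: f_def inner_rot inner_add_left inner_diff_right crs_def algebra_simps)
  have fa': "f R a' = f R a" for R
    using diff[of R a'] eq by (simp add: crs_def inner_diff_right)
  have "\<forall>\<^sub>F R in at_top. f R x > f R a" if x: "x \<in> A - {a, a'}" for x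
  proof (cases "crs (a' - a) (x - a) = 0")
    case True
    define l where "l = ((a' - a) \<bullet> (x - a)) / ((a' - a) \<bullet> (a' - a))"
    have xl: "x - a = l *\<^sub>R (a' - a)"
      unfolding l_def using aA by (intro crs_eq_0_scaleR True) simp
    then have x_eq: "x = a + l *\<^sub>R (a' - a)"
      by (simp add: algebra_simps)
    have "l < 0 \<or> l > 1"
    proof (rule ccontr)
      assume "\<not> (l < 0 \<or> l > 1)"
      moreover have "l \<noteq> 0" "l \<noteq> 1"
        using x x_eq by auto
      ultimately have "0 < l" "l < 1"
        by auto
      moreover have "x = (1 - l) *\<^sub>R a + l *\<^sub>R a'"
        using x_eq by (simp add: algebra_simps)
      ultimately have "x \<in> open_segment a a'"
        using aA(3) unfolding in_segment by blast
      then show False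
        using seg x by blast
    qed
    then have "(1 - l) * \<alpha> a + l * \<alpha> a' < \<alpha> x"
      using cvx aA x x_eq unfolding convex_on_lines_def by blast
    moreover have "w \<bullet> (x - a) = l * (\<alpha> a - \<alpha> a')"
      using eq unfolding xl by (simp add: inner_diff_right)
    ultimately have "w \<bullet> (x - a) + \<alpha> x - \<alpha> a > 0"
      by (simp add: algebra_simps)
    then have "f R x > f R a" for R
      using diff[of R x] True by simp
    then show ?thesis
      by simp
  next
    case False
    define k where "k = s * crs (a' - a) (x - a)"
    have "k > 0"
      using False left[of x] x \<open>s > 0\<close> by (simp add: k_def)
    have "\<forall>\<^sub>F R in at_top. R > - (w \<bullet> (x - a) + \<alpha> x - \<alpha> a) / k"
      by (rule eventually_gt_at_top)
    then show ?thesis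
    proof (rule eventually_mono)
      fix R assume "R > - (w \<bullet> (x - a) + \<alpha> x - \<alpha> a) / k"
      then have "R * k > - (w \<bullet> (x - a) + \<alpha> x - \<alpha> a)"
        using \<open>k > 0\<close> by (simp add: pos_divide_less_eq)
      then show "f R x > f R a"
        using diff[of R x] by (simp add: k_def)
    qed
  qed
  then have "\<forall>\<^sub>F R in at_top. \<forall>x\<in>A - {a, a'}. f R x > f R a"
    using assms(1) by (intro eventually_ball_finite) auto
  then show ?thesis
  proof (rule eventually_mono)
    fix R assume gt: "\<forall>x\<in>A - {a, a'}. f R x > f R a"
    have ge: "f R x \<ge> f R a" if "x \<in> A" for x
      using gt fa' that by (cases "x \<in> {a, a'}") (auto intro: less_imp_le)
    have a_low: "a \<in> low A \<alpha> ((R * s) *\<^sub>R rot (a' - a) + w)"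
      using ge aA by (simp add: minset_def f_def)
    have iff: "x \<in> low A \<alpha> ((R * s) *\<^sub>R rot (a' - a) + w) \<longleftrightarrow> x \<in> A \<and> f R x = f R a" for x
      unfolding f_def by (rule minset_value[OF a_low])
    show "low A \<alpha> ((R * s) *\<^sub>R rot (a' - a) + w) = {a, a'}"
    proof (rule set_eqI)
      fix x show "x \<in> low A \<alpha> ((R * s) *\<^sub>R rot (a' - a) + w) \<longleftrightarrow> x \<in> {a, a'}"
        unfolding iff using gt[rule_format, of x] fa'[of R] aA by (cases "x \<in> {a, a'}") auto
    qed
  qed
qed

lemma low_add_linear: "low B (\<lambda>b. \<beta> b + p \<bullet> b) w = low B \<beta> (w + p)"
  by (simp add: minset_def inner_add_left algebra_simps)

text \<open>In the dual plane the ray of the edge of A starts at w1 with direction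
  \<open>rot e\<close>; that of B has direction \<open>rot f\<close> and starts at w1 shifted by
  \<open>- R * rot v\<close>. The sign conditions say that these rays cross, and for large R the
  crossing is far out on both.\<close>

lemma eventually_low_crossing:
  assumes fin: "finite A" "finite B" and cvx: "convex_on_lines A \<alpha>" "convex_on_lines B \<beta>"
    and e: "(a, a') \<in> boundary_edges A" and f: "(b, b') \<in> boundary_edges B"
    and c1: "crs (b' - b) (a' - a) * crs v (a' - a) > 0"
    and c2: "crs (b' - b) (a' - a) * crs v (b' - b) > 0"
  shows "\<forall>\<^sub>F R in at_top. \<exists>w. low A \<alpha> w = {a, a'} \<and> low B (\<lambda>b. \<beta> b + R * (rot v \<bullet> b)) w = {b, b'}"
proof -
  define e f where "e = a' - a" and "f = b' - b"
  have c: "crs f e \<noteq> 0"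
    using c1 by (auto simp: e_def f_def)
  \<comment> \<open>Cramer's rule for writing v as \<open>t f - s e\<close>; the two sign conditions
    state that t and s are positive.\<close>
  define s t where "s = crs v f / crs f e" and "t = crs v e / crs f e"
  have st: "s > 0" "t > 0"
    using c1 c2 unfolding s_def t_def e_def[symmetric] f_def[symmetric]
    by (auto simp: zero_less_divide_iff zero_less_mult_iff)
  have "v = t *\<^sub>R f - s *\<^sub>R e"
  proof -
    have "crs f e * v$1 = crs v e * f$1 - crs v f * e$1" "crs f e * v$2 = crs v e * f$2 - crs v f * e$2"
      unfolding crs_def by algebra+
    then show ?thesis
      using c by (simp add: vec_eq_iff forall_2 s_def t_def field_simps)
  qed
  then have rot_v: "rot v = t *\<^sub>R rot f - s *\<^sub>R rot e"
    by (simp add: rot_def vec_eq_iff forall_2)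
  define k k' where "k = \<alpha> a - \<alpha> a'" and "k' = \<beta> b - \<beta> b'"
  \<comment> \<open>The common apex: the solution of \<open>w1 \<bullet> e = k\<close> and
    \<open>w1 \<bullet> f = k'\<close>, where both edges have equal values at their ends.\<close>
  define w1 :: plane where "w1 = vector [(k' * e$2 - k * f$2) / crs f e, (k * f$1 - k' * e$1) / crs f e]"
  have "w1 \<bullet> e = (k * (f$1 * e$2 - f$2 * e$1)) / crs f e"
    by (simp add: w1_def inner_vec_def sum_2 add_divide_distrib[symmetric] algebra_simps)
  then have w1e: "w1 \<bullet> e = k"
    using c by (simp add: crs_def)
  have "w1 \<bullet> f = (k' * (f$1 * e$2 - f$2 * e$1)) / crs f e"
    by (simp add: w1_def inner_vec_def sum_2 add_divide_distrib[symmetric] algebra_simps)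
  then have w1f: "w1 \<bullet> f = k'"
    using c by (simp add: crs_def)
  have "\<forall>\<^sub>F R in at_top. low A \<alpha> ((R * s) *\<^sub>R rot (a' - a) + w1) = {a, a'}"
    using fin cvx assms(5) w1e st
    by (intro eventually_low_boundary_edge) (auto simp: e_def k_def inner_diff_right)
  moreover have "\<forall>\<^sub>F R in at_top. low B \<beta> ((R * t) *\<^sub>R rot (b' - b) + w1) = {b, b'}"
    using fin cvx assms(6) w1f st
    by (intro eventually_low_boundary_edge) (auto simp: f_def k'_def inner_diff_right)
  ultimately show ?thesis
  proof (rule eventually_elim2)
    fix R
    assume A: "low A \<alpha> ((R * s) *\<^sub>R rot (a' - a) + w1) = {a, a'}"
      and B: "low B \<beta> ((R * t) *\<^sub>R rot (b' - b) + w1) = {b, b'}"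
    define w where "w = (R * s) *\<^sub>R rot e + w1"
    have "w + R *\<^sub>R rot v = (R * t) *\<^sub>R rot (b' - b) + w1"
      unfolding rot_v w_def f_def by (simp add: scaleR_diff_right)
    then have "low B (\<lambda>b. \<beta> b + R * (rot v \<bullet> b)) w = {b, b'}"
      using low_add_linear[of B \<beta> "R *\<^sub>R rot v" w] B by (simp only: inner_scaleR_left)
    moreover have "low A \<alpha> w = {a, a'}"
      using A by (simp add: w_def e_def)
    ultimately show "\<exists>w. low A \<alpha> w = {a, a'} \<and> low B (\<lambda>b. \<beta> b + R * (rot v \<bullet> b)) w = {b, b'}"
      by blast
  qed
qed

section \<open>Counting triangles and parallelograms\<close>

lemma card_3_sorted:
  fixes g :: "'a \<Rightarrow> real"
  assumes "card C = 3" "inj_on g C"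
  shows "\<exists>l m u. C = {l, m, u} \<and> g l < g m \<and> g m < g u"
proof -
  obtain p q r where C: "C = {p, q, r}" and ne: "p \<noteq> q" "p \<noteq> r" "q \<noteq> r"
    using assms(1) by (auto simp: card_3_iff)
  have "g p \<noteq> g q" "g p \<noteq> g r" "g q \<noteq> g r"
    using assms(2) ne by (auto simp: C inj_on_def)
  then consider "g p < g q" "g q < g r" | "g p < g r" "g r < g q" | "g q < g p" "g p < g r"
    | "g q < g r" "g r < g p" | "g r < g p" "g p < g q" | "g r < g q" "g q < g p"
    by linarith
  then show ?thesis
    unfolding C by cases (metis insert_commute)+
qed

text \<open>The intersection is a face of both sets, and a face that contains an interior point is
  the whole set.\<close>

lemma simplicial_triangles_disjoint_interior:
  assumes "simplicial_complex T" "F \<in> T" "G \<in> T" "y \<in> interior F" "y \<in> interior G"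
  shows "F = G"
proof -
  have faces: "(F \<inter> G) face_of F" "(F \<inter> G) face_of G"
    using assms(1-3) unfolding simplicial_complex_def by (metis Int_commute)+
  have "y \<in> F \<inter> G"
    using assms(4,5) interior_subset by blast
  then have "F \<inter> G = F" "F \<inter> G = G"
    using face_of_disjoint_interior[OF faces(1)] face_of_disjoint_interior[OF faces(2)] assms(4,5) by blast+
  then show ?thesis
    by blast
qed

text \<open>A triangle meets the horizontal line through its middle vertex in a segment starting at that
  vertex. As the vertex lies on the boundary of the convex hull, two triangles with the same middle
  vertex leave it on the same side, so that their interiors meet.\<close>

lemma triangle_eq_of_middle_vertex:
  fixes A :: "plane set" and \<rho> :: real
  defines "g \<equiv> \<lambda>x :: plane. x$1 + \<rho> * x$2"
  assumes T: "simplicial_complex T" and nc: "\<not> collinear A" and fr: "A \<subseteq> frontier (convex hull A)"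
    and F: "convex hull {l, m, u} \<in> T" and ind: "\<not> affine_dependent {l, m, u}"
    and F': "convex hull {l', m, u'} \<in> T" and ind': "\<not> affine_dependent {l', m, u'}"
    and A: "{l, m, u, l', u'} \<subseteq> A"
    and ord: "g l < g m" "g m < g u" "g l' < g m" "g m < g u'"
  shows "convex hull {l, m, u} = convex hull {l', m, u'}"
proof -
  obtain c where c: "c \<noteq> 0" "\<And>x. x \<in> A \<Longrightarrow> 0 \<le> c \<bullet> (x - m)"
    using frontier_supporting[OF nc fr, of m] A by auto
  \<comment> \<open>The direction of the level lines of g, which play the part of horizontal
    lines.\<close>
  define d :: plane where "d = vector [- \<rho>, 1]"
  have cd: "c \<bullet> d = c$2 - \<rho> * c$1"
    by (simp add: d_def inner_vec_def sum_2)
  have side: "\<exists>\<kappa>. \<kappa> * (c \<bullet> d) > 0 \<and> (\<forall>s. 0 < s \<and> s < 1 \<longrightarrow> m + (s * \<kappa>) *\<^sub>R d \<in> interior (convex hull {l, m, u}))"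
    if ind: "\<not> affine_dependent {l, m, u}" and A: "l \<in> A" "u \<in> A" and ord: "g l < g m" "g m < g u" for l u
  proof -
    \<comment> \<open>The point z of the edge from l to u at the level of m; from m the triangle
      extends along the level line towards z.\<close>
    define \<theta> where "\<theta> = (g m - g l) / (g u - g l)"
    have \<theta>: "0 < \<theta>" "\<theta> < 1"
      using ord by (auto simp: \<theta>_def field_simps)
    define z where "z = (1 - \<theta>) *\<^sub>R l + \<theta> *\<^sub>R u"
    have "g z = g l + \<theta> * (g u - g l)"
      by (simp add: g_def z_def algebra_simps)
    then have "g z = g m"
      using ord by (simp add: \<theta>_def)
    define \<kappa> where "\<kappa> = (z - m)$2"
    have zm: "z - m = \<kappa> *\<^sub>R d"
      using \<open>g z = g m\<close> by (simp add: \<kappa>_def d_def g_def vec_eq_iff forall_2 algebra_simps)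
    have nc3: "\<not> collinear {l, m, u}"
      using ind ord by (auto simp: collinear_3_eq_affine_dependent)
    have "\<kappa> \<noteq> 0"
    proof
      assume "\<kappa> = 0"
      then have "m = (1 - \<theta>) *\<^sub>R l + \<theta> *\<^sub>R u"
        using zm by (simp add: z_def)
      then have "m \<in> closed_segment l u"
        using \<theta> unfolding in_segment by (metis less_imp_le)
      then have "collinear {l, m, u}"
        using between_imp_collinear between_mem_segment by blast
      then show False
        using nc3 by blast
    qed
    \<comment> \<open>Otherwise c would be a multiple of the gradient of g and m an extreme point
      for g, but l and u lie on different sides of its level line.\<close>
    moreover have "c \<bullet> d \<noteq> 0"
    proof
      assume "c \<bullet> d = 0"
      then have c2: "c$2 = \<rho> * c$1"
        using cd by simp
      then have "c \<bullet> (x - m) = c$1 * (g x - g m)" for x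
        by (simp add: g_def inner_vec_def sum_2 algebra_simps)
      then have "c$1 * (g l - g m) \<ge> 0" "c$1 * (g u - g m) \<ge> 0"
        using c(2)[OF A(1)] c(2)[OF A(2)] by simp_all
      then have "c$1 = 0"
        using ord by (simp add: zero_le_mult_iff)
      then show False
        using c(1) c2 by (simp add: vec_eq_iff forall_2)
    qed
    moreover have "\<kappa> * (c \<bullet> d) \<ge> 0"
    proof -
      have "z - m = (1 - \<theta>) *\<^sub>R (l - m) + \<theta> *\<^sub>R (u - m)"
        by (simp add: z_def algebra_simps)
      then have "c \<bullet> (z - m) = (1 - \<theta>) * (c \<bullet> (l - m)) + \<theta> * (c \<bullet> (u - m))"
        by (simp only: inner_add_right inner_scaleR_right)
      then show ?thesis
        using c(2)[OF A(1)] c(2)[OF A(2)] \<theta> unfolding zm by simp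
    qed
    ultimately have "\<kappa> * (c \<bullet> d) > 0"
      by (simp add: less_le)
    moreover have "m + (s * \<kappa>) *\<^sub>R d \<in> interior (convex hull {l, m, u})" if "0 < s" "s < 1" for s
    proof -
      have "m + (s * \<kappa>) *\<^sub>R d = m + s *\<^sub>R (z - m)"
        by (simp add: zm)
      also have "\<dots> = (s * (1 - \<theta>)) *\<^sub>R l + (1 - s) *\<^sub>R m + (s * \<theta>) *\<^sub>R u"
        by (simp add: z_def algebra_simps)
      finally have eq: "(s * (1 - \<theta>)) *\<^sub>R l + (1 - s) *\<^sub>R m + (s * \<theta>) *\<^sub>R u = m + (s * \<kappa>) *\<^sub>R d" ..
      have "0 < s * (1 - \<theta>)" "0 < 1 - s" "0 < s * \<theta>" "s * (1 - \<theta>) + (1 - s) + s * \<theta> = 1"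
        using that \<theta> by (auto simp: algebra_simps)
      then show ?thesis
        unfolding interior_convex_hull_3_minimal[OF nc3, simplified]
        by (intro CollectI exI[of _ "s * (1 - \<theta>)"] exI[of _ "1 - s"] exI[of _ "s * \<theta>"] conjI eq)
    qed
    ultimately show ?thesis
      by (intro exI[of _ \<kappa>]) simp
  qed
  obtain \<kappa> where \<kappa>: "\<kappa> * (c \<bullet> d) > 0" "\<And>s. 0 < s \<Longrightarrow> s < 1 \<Longrightarrow> m + (s * \<kappa>) *\<^sub>R d \<in> interior (convex hull {l, m, u})"
    using side[OF ind _ _ ord(1,2)] A by auto
  obtain \<kappa>' where \<kappa>': "\<kappa>' * (c \<bullet> d) > 0" "\<And>s. 0 < s \<Longrightarrow> s < 1 \<Longrightarrow> m + (s * \<kappa>') *\<^sub>R d \<in> interior (convex hull {l', m, u'})"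
    using side[OF ind' _ _ ord(3,4)] A by auto
  \<comment> \<open>The weights are chosen to give \<open>s * \<kappa> = s' * \<kappa>'\<close>, a
    common point of both interiors; they lie between 0 and 1 because \<kappa> and \<kappa>' have the
    same sign, that of \<open>c \<bullet> d\<close>.\<close>
  define s s' where "s = \<kappa>' / (\<kappa> + \<kappa>')" and "s' = \<kappa> / (\<kappa> + \<kappa>')"
  have signs: "(\<kappa> > 0 \<and> \<kappa>' > 0) \<or> (\<kappa> < 0 \<and> \<kappa>' < 0)"
    using \<kappa>(1) \<kappa>'(1) by (auto simp: zero_less_mult_iff)
  then have "0 < s" "s < 1" "0 < s'" "s' < 1"
    by (auto simp: s_def s'_def field_simps)
  moreover have "s * \<kappa> = s' * \<kappa>'"
    by (simp add: s_def s'_def)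
  ultimately have "m + (s * \<kappa>) *\<^sub>R d \<in> interior (convex hull {l, m, u})"
    "m + (s * \<kappa>) *\<^sub>R d \<in> interior (convex hull {l', m, u'})"
    using \<kappa>(2)[of s] \<kappa>'(2)[of s'] by simp_all
  then show ?thesis
    by (rule simplicial_triangles_disjoint_interior[OF T F F'])
qed

text \<open>As g separates the points of A, every triangle has a middle vertex. It is neither the
  lowest nor the highest point of A, which accounts for the 2.\<close>

lemma card_triangles_le:
  assumes "finite A" and nc: "\<not> collinear A" and fr: "A \<subseteq> frontier (convex hull A)"
    and T: "triangulation_of A T"
  shows "card (triangles T) + 2 \<le> card A"
proof -
  have sc: "simplicial_complex T" and vert: "{v. {v} \<in> T} = A"
    using T by (auto simp: triangulation_of_def)
  define D where "D = (\<lambda>(x, y). x - y) ` {(x, y) \<in> A \<times> A. x \<noteq> y}"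
  have "D \<subseteq> (\<lambda>(x, y). x - y) ` (A \<times> A)"
    by (auto simp: D_def)
  then have "finite D"
    by (rule finite_subset) (simp add: assms(1))
  moreover have "0 \<notin> D"
    by (auto simp: D_def)
  ultimately obtain \<rho> where \<rho>: "\<And>d. d \<in> D \<Longrightarrow> d$1 + \<rho> * d$2 \<noteq> 0"
    using finite_ex_shear by blast
  define g where "g = (\<lambda>x :: plane. x$1 + \<rho> * x$2)"
  have inj: "inj_on g A"
  proof (rule inj_onI)
    fix x y assume "x \<in> A" "y \<in> A" "g x = g y"
    then have "(x - y)$1 + \<rho> * (x - y)$2 = 0"
      by (simp add: g_def algebra_simps)
    then have "x - y \<notin> D"
      using \<rho> by blast
    then show "x = y"
      using \<open>x \<in> A\<close> \<open>y \<in> A\<close> by (force simp: D_def)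
  qed
  define mid where "mid F m \<longleftrightarrow> (\<exists>l u. F = convex hull {l, m, u} \<and> {l, m, u} \<subseteq> A \<and>
      \<not> affine_dependent {l, m, u} \<and> g l < g m \<and> g m < g u)" for F m
  have "\<exists>m. mid F m" if F: "F \<in> triangles T" for F
  proof -
    have "F \<in> T" and "2 simplex F"
      using F by (auto simp: triangles_def)
    then obtain C where C: "\<not> affine_dependent C" "card C = 3" "F = convex hull C"
      by (auto simp: simplex_def)
    have "C \<subseteq> A"
    proof
      fix v assume "v \<in> C"
      then have "{v} face_of F"
        unfolding C(3) face_of_singleton using extreme_point_of_convex_hull_affine_independent[OF C(1)] by blast
      then have "{v} \<in> T"
        using sc \<open>F \<in> T\<close> unfolding simplicial_complex_def by blast
      then show "v \<in> A"
        using vert by blast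
    qed
    then obtain l m u where "C = {l, m, u}" "g l < g m" "g m < g u"
      using card_3_sorted[OF C(2), of g] inj inj_on_subset by blast
    then show ?thesis
      using C \<open>C \<subseteq> A\<close> unfolding mid_def by blast
  qed
  then obtain M where M: "\<And>F. F \<in> triangles T \<Longrightarrow> mid F (M F)"
    by metis
  have "A \<noteq> {}"
    using nc by auto
  obtain lo where lo: "lo \<in> A" "\<And>x. x \<in> A \<Longrightarrow> g lo \<le> g x"
    using finite_ex_minimum[OF assms(1) \<open>A \<noteq> {}\<close>, of g] by blast
  obtain hi where hi: "hi \<in> A" "\<And>x. x \<in> A \<Longrightarrow> - g hi \<le> - g x"
    using finite_ex_minimum[OF assms(1) \<open>A \<noteq> {}\<close>, of "\<lambda>x. - g x"] by blast
  have "lo \<noteq> hi"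
  proof
    assume "lo = hi"
    then have "g x = g lo" if "x \<in> A" for x
      using lo(2)[OF that] hi(2)[OF that] by simp
    then have "A \<subseteq> {lo}"
      using inj_onD[OF inj _ _ lo(1)] by blast
    then show False
      using nc collinear_subset collinear_sing by blast
  qed
  have "inj_on M (triangles T)"
  proof (rule inj_onI)
    fix F F' assume F: "F \<in> triangles T" "F' \<in> triangles T" and eq: "M F = M F'"
    obtain l u where lu: "F = convex hull {l, M F, u}" "{l, M F, u} \<subseteq> A"
        "\<not> affine_dependent {l, M F, u}" "g l < g (M F)" "g (M F) < g u"
      using M[OF F(1)] unfolding mid_def by blast
    obtain l' u' where lu': "F' = convex hull {l', M F, u'}" "{l', M F, u'} \<subseteq> A"
        "\<not> affine_dependent {l', M F, u'}" "g l' < g (M F)" "g (M F) < g u'"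
      using M[OF F(2)] unfolding mid_def eq by blast
    have FT: "convex hull {l, M F, u} \<in> T" "convex hull {l', M F, u'} \<in> T"
      using F lu(1) lu'(1) by (auto simp: triangles_def)
    have sub: "{l, M F, u, l', u'} \<subseteq> A"
      using lu(2) lu'(2) by simp
    note ord = lu(4,5) lu'(4,5)
    have "convex hull {l, M F, u} = convex hull {l', M F, u'}"
      by (rule triangle_eq_of_middle_vertex[OF sc nc fr FT(1) lu(3) FT(2) lu'(3) sub ord[unfolded g_def]])
    then show "F = F'"
      by (rule box_equals[OF _ lu(1)[symmetric] lu'(1)[symmetric]])
  qed
  moreover have "M ` triangles T \<subseteq> A - {lo, hi}"
  proof
    fix m assume "m \<in> M ` triangles T"
    then obtain F where "F \<in> triangles T" "m = M F"
      by blast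
    then have "mid F m"
      using M by simp
    then obtain l u where "l \<in> A" "m \<in> A" "u \<in> A" "g l < g m" "g m < g u"
      unfolding mid_def by blast
    then show "m \<in> A - {lo, hi}"
      using lo(2)[of l] hi(2)[of u] by auto
  qed
  ultimately have "card (triangles T) \<le> card (A - {lo, hi})"
    using assms(1) by (meson card_inj_on_le finite_Diff)
  also have "\<dots> = card A - 2"
    using lo hi \<open>lo \<noteq> hi\<close> by (simp add: card_Diff_subset)
  finally have "card (triangles T) \<le> card A - 2" .
  moreover have "card {lo, hi} \<le> card A"
    using lo hi assms(1) by (intro card_mono) auto
  ultimately show ?thesis
    using \<open>lo \<noteq> hi\<close> by simp
qed

section \<open>Parallelograms from crossings, and the final choice of heights\<close>

lemma three_le_card_noncollinear:
  assumes "finite A" "\<not> collinear (A :: plane set)"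
  shows "3 \<le> card A"
proof -
  have "aff_dim A \<le> int (card A) - 1"
    using aff_dim_le_card[OF assms(1)] .
  then show ?thesis
    using aff_dim_plane_noncollinear[OF assms(2)] by simp
qed

text \<open>Different crossing pairs give different parallelograms: a segment determines its set of
  ends, and asymmetry of the boundary edges determines their order.\<close>

lemma card_parallelograms_ge_crossings:
  assumes fin: "finite A" "finite B" and nc: "\<not> collinear A" "\<not> collinear B"
    and cay: "\<And>w. cayley_independent (low A \<alpha> w) (low B \<beta> w)"
    and real: "\<And>a a' b b'. ((a, a'), (b, b')) \<in> K \<Longrightarrow> \<exists>w. low A \<alpha> w = {a, a'} \<and> low B \<beta> w = {b, b'}"
    and K: "K \<subseteq> boundary_edges A \<times> boundary_edges B"
  shows "card K \<le> card (parallelograms (range (\<lambda>w. (low_cell A \<alpha> w, low_cell B \<beta> w))))"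
proof -
  define M where "M = range (\<lambda>w. (low_cell A \<alpha> w, low_cell B \<beta> w))"
  define \<Phi> where "\<Phi> = (\<lambda>((a, a'), (b, b')). (convex hull {a, a' :: plane}, convex hull {b, b' :: plane}))"
  have "M \<subseteq> range (low_cell A \<alpha>) \<times> range (low_cell B \<beta>)"
    by (auto simp: M_def)
  moreover have "finite (range (low_cell A \<alpha>) \<times> range (low_cell B \<beta>))"
    using finite_cells[OF fin(1)] finite_cells[OF fin(2)] by (intro finite_cartesian_product)
  ultimately have "finite M"
    using finite_subset by blast
  then have "finite (parallelograms M)"
    unfolding parallelograms_def by (rule rev_finite_subset) auto
  moreover have "\<Phi> ` K \<subseteq> parallelograms M"
  proof
    fix P assume "P \<in> \<Phi> ` K"
    then obtain a a' b b' where k: "((a, a'), (b, b')) \<in> K"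
      and P: "P = (convex hull {a, a'}, convex hull {b, b'})"
      by (auto simp: \<Phi>_def)
    obtain w where "low A \<alpha> w = {a, a'}" "low B \<beta> w = {b, b'}"
      using real[OF k] by blast
    moreover have "a \<noteq> a'" "b \<noteq> b'"
      using K k by (auto simp: boundary_edges_def)
    ultimately show "P \<in> parallelograms M"
      unfolding P M_def by (intro parallelogram_low_cells[OF fin nc cay])
  qed
  ultimately have "card (\<Phi> ` K) \<le> card (parallelograms M)"
    by (rule card_mono)
  moreover have "inj_on \<Phi> K"
  proof (rule inj_onI)
    have edge_eq: "(x, x') = (y, y')"
      if "convex hull {x, x'} = convex hull {y, y'}" "(x, x') \<in> boundary_edges X" "(y, y') \<in> boundary_edges X"
        "\<not> collinear X" for x x' y y' :: plane and X
    proof -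
      have "{x, x'} = {y, y'}"
        using that(1) by (simp flip: segment_convex_hull)
      then show ?thesis
        using boundary_edges_asym[OF that(4,2)] that(3) by (auto simp: doubleton_eq_iff)
    qed
    fix k k' assume k: "k \<in> K" "k' \<in> K" "\<Phi> k = \<Phi> k'"
    obtain a a' b b' where [simp]: "k = ((a, a'), (b, b'))"
      by (metis prod.exhaust)
    obtain c c' d d' where [simp]: "k' = ((c, c'), (d, d'))"
      by (metis prod.exhaust)
    have "(a, a') \<in> boundary_edges A" "(c, c') \<in> boundary_edges A"
      "(b, b') \<in> boundary_edges B" "(d, d') \<in> boundary_edges B"
      using k(1,2) K by auto
    moreover have "convex hull {a, a'} = convex hull {c, c'}" "convex hull {b, b'} = convex hull {d, d'}"
      using k(3) by (simp_all add: \<Phi>_def)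
    ultimately have "(a, a') = (c, c')" "(b, b') = (d, d')"
      using edge_eq nc by blast+
    then show "k = k'"
      by simp
  qed
  ultimately show ?thesis
    unfolding M_def by (simp add: card_image)
qed

theorem theorem1p8:
  fixes A B :: "plane set"
  assumes "finite A" and "\<not> collinear A" and "A \<subseteq> frontier (convex hull A)"
    and "finite B" and "\<not> collinear B" and "B \<subseteq> frontier (convex hull B)"
  shows "\<exists>TA TB M. triangulation_of A TA \<and> triangulation_of B TB \<and>
           mixed_subdivision A B TA TB M \<and>
           real (card (parallelograms M)) \<ge>
             sqrt (real (card (triangles TA)) * real (card (triangles TB)))"
proof -
  let ?E = "boundary_edges A" and ?F = "boundary_edges B"
  let ?u = "\<lambda>e :: plane \<times> plane. snd e - fst e"
  have cardE: "card A \<le> card ?E" and cardF: "card B \<le> card ?F"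
    using card_boundary_edges_ge assms by blast+
  have card3: "3 \<le> card A" "3 \<le> card B"
    using three_le_card_noncollinear assms by blast+
  have "\<exists>v. real (card (crossings ?E ?u ?F ?u v)) \<ge> sqrt ((real (card ?E) - 2) * (real (card ?F) - 2))"
  proof (rule exists_crossings_ge)
    show "finite ?E" "finite ?F"
      using assms finite_boundary_edges by blast+
    show "?u e \<noteq> 0" if "e \<in> ?E" for e
      using that by (auto simp: boundary_edges_def)
    show "?u e \<noteq> 0" if "e \<in> ?F" for e
      using that by (auto simp: boundary_edges_def)
    show "2 \<le> card {e \<in> ?E. crs d (?u e) \<noteq> 0}" if "d \<noteq> 0" for d
      using two_le_card_nonparallel_edges[OF assms(1-3) that] .
    show "2 \<le> card {e \<in> ?F. crs d (?u e) \<noteq> 0}" if "d \<noteq> 0" for d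
      using two_le_card_nonparallel_edges[OF assms(4-6) that] .
    show "3 \<le> card ?E" "3 \<le> card ?F"
      using card3 cardE cardF by linarith+
  qed
  then obtain v where v: "real (card (crossings ?E ?u ?F ?u v)) \<ge> sqrt ((real (card ?E) - 2) * (real (card ?F) - 2))"
    by blast
  define K where "K = crossings ?E ?u ?F ?u v"
  have K: "K \<subseteq> ?E \<times> ?F"
    unfolding K_def crossings_def by auto
  obtain \<alpha> \<beta> where cvx: "convex_on_lines A \<alpha>" "convex_on_lines B \<beta>"
    and vert: "\<forall>a\<in>A. \<exists>w. low A \<alpha> w = {a}" "\<forall>b\<in>B. \<exists>w. low B \<beta> w = {b}"
    and generic: "\<forall>p. \<forall>\<^sub>F R in at_top. \<forall>w. cayley_independent (low A \<alpha> w) (low B (\<lambda>b. \<beta> b + R * (p \<bullet> b)) w)"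
    by (rule exists_generic_heights[OF assms(1,4)])
  have "\<forall>\<^sub>F R in at_top. \<exists>w. low A \<alpha> w = {fst (fst k), snd (fst k)} \<and>
      low B (\<lambda>b. \<beta> b + R * (rot v \<bullet> b)) w = {fst (snd k), snd (snd k)}" if "k \<in> K" for k
    using that unfolding K_def crossings_def
    by (intro eventually_low_crossing[OF assms(1,4) cvx, where v = v]) auto
  moreover have "finite K"
    using finite_boundary_edges[OF assms(1)] finite_boundary_edges[OF assms(4)]
    by (intro finite_subset[OF K] finite_cartesian_product)
  ultimately have "\<forall>\<^sub>F R in at_top. \<forall>k\<in>K. \<exists>w. low A \<alpha> w = {fst (fst k), snd (fst k)} \<and>
      low B (\<lambda>b. \<beta> b + R * (rot v \<bullet> b)) w = {fst (snd k), snd (snd k)}"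
    by (intro eventually_ball_finite) auto
  \<comment> \<open>Every crossing is realized for all large R, and so is general position; finitely
    many such conditions have a common R.\<close>
  from eventually_happens'[OF trivial_limit_at_top_linorder eventually_conj[OF this generic[rule_format, of "rot v"]]]
  obtain R :: real where R: "(\<forall>k\<in>K. \<exists>w. low A \<alpha> w = {fst (fst k), snd (fst k)} \<and>
      low B (\<lambda>b. \<beta> b + R * (rot v \<bullet> b)) w = {fst (snd k), snd (snd k)}) \<and>
      (\<forall>w. cayley_independent (low A \<alpha> w) (low B (\<lambda>b. \<beta> b + R * (rot v \<bullet> b)) w))"
    by (rule exE)
  define \<gamma> where "\<gamma> b = \<beta> b + R * (rot v \<bullet> b)" for b
  have low\<gamma>: "low B \<gamma> w = low B \<beta> (w + R *\<^sub>R rot v)" for w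
    using low_add_linear[of B \<beta> "R *\<^sub>R rot v" w] unfolding \<gamma>_def by simp
  have cay: "cayley_independent (low A \<alpha> w) (low B \<gamma> w)" for w
    using R unfolding \<gamma>_def by blast
  have real: "\<exists>w. low A \<alpha> w = {a, a'} \<and> low B \<gamma> w = {b, b'}" if "((a, a'), (b, b')) \<in> K" for a a' b b'
    using R that unfolding \<gamma>_def by force
  \<comment> \<open>A linear term only translates the gradients, so every point of B remains a
    vertex.\<close>
  have vert\<gamma>: "\<exists>w. low B \<gamma> w = {b}" if b: "b \<in> B" for b
  proof -
    obtain w where "low B \<beta> w = {b}"
      using vert(2) b by blast
    then show ?thesis
      by (intro exI[of _ "w - R *\<^sub>R rot v"]) (simp add: low\<gamma>)
  qed
  have fin_low: "finite (low A \<alpha> w)" "finite (low B \<gamma> w)" for w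
    using finite_subset[OF minset_subset assms(1)] finite_subset[OF minset_subset assms(4)] by blast+
  define TA TB M where "TA = insert {} (range (low_cell A \<alpha>))" and "TB = insert {} (range (low_cell B \<gamma>))"
    and "M = range (\<lambda>w. (low_cell A \<alpha> w, low_cell B \<gamma> w))"
  have TA: "triangulation_of A TA"
    unfolding TA_def using cayley_independent_affine[OF cay fin_low(1)] vert(1)[rule_format]
    by (rule triangulation_of_low_cells[OF assms(1,2)])
  have TB: "triangulation_of B TB"
    unfolding TB_def
    using cayley_independent_affine[OF cayley_independent_sym[OF cay] fin_low(2)] vert\<gamma>
    by (rule triangulation_of_low_cells[OF assms(4,5)])
  have M: "mixed_subdivision A B TA TB M"
    unfolding TA_def TB_def M_def by (rule mixed_subdivision_low_cells[OF assms(1,4,2,5) cay])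
  have "card K \<le> card (parallelograms M)"
    unfolding M_def by (rule card_parallelograms_ge_crossings[OF assms(1,4,2,5) cay real K])
  \<comment> \<open>The triangles of each triangulation number at most the points minus 2, hence at
    most the boundary edges minus 2.\<close>
  moreover have "sqrt (real (card (triangles TA)) * real (card (triangles TB)))
      \<le> sqrt ((real (card ?E) - 2) * (real (card ?F) - 2))"
    using card_triangles_le[OF assms(1-3) TA] card_triangles_le[OF assms(4-6) TB] cardE cardF
    by (intro real_sqrt_le_mono mult_mono) auto
  ultimately have "sqrt (real (card (triangles TA)) * real (card (triangles TB))) \<le> real (card (parallelograms M))"
    using v unfolding K_def by linarith
  then show ?thesis
    using TA TB M by blast
qed

end
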